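(* Let $k\in\mathbb{N}$, $W=(w_1,\dots,w_k)\in\mathbb{R}^k$, and let $A_N$ be drawn from the $N\times N$ $(k,W)$-checkerboard ensemble, independently for each $N$. Suppose that exactly $x$ of the entries of $W$ are nonzero, and let $w'_1,\dots,w'_s$ be the distinct nonzero values occurring among $w_1,\dots,w_k$, with $w'_i$ occurring exactly $k_i$ times (so $k_1+\dots+k_s=x$). Then for every $\epsilon>0$, almost surely, as $N\to\infty$ the eigenvalues of $A_N$ split into $s+1$ regimes: $N-x$ of the eigenvalues are $O(N^{1/2+\epsilon})$, and for each $i\in\{1,\dots,s\}$ exactly $k_i$ eigenvalues are of the form $Nw'_i/k+O(N^{1/2+\epsilon})$.
   Context: Fix $k\in\mathbb N$ and $W=(w_1,\dots,w_k)\in\mathbb R^k$. The $N\times N$ $(k,W)$-checkerboard ensemble consists of real symmetric matrices $M=(m_{ij})$ with $m_{ij}=w_u$ if $i\equiv j\equiv u \pmod k$ (where $u\in\{1,\dots,k\}$) and $m_{ij}=a_{ij}$ if $i\not\equiv j\pmod k$, where the $a_{ij}=a_{ji}$ ($i<j$) are i.i.d. real random variables with mean $0$, variance $1$ and finite moments of all orders, with the natural product probability measure. *)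

theory Defs
  imports "HOL-Probability.Probability" "Jordan_Normal_Form.Char_Poly"
begin

text \<open>Entry (i,j) (1-indexed, 1 <= i,j <= N) of the (k,W)-checkerboard matrix with
  off-pattern entries a (used for i < j, symmetrised for i > j).
  W is indexed by 1..k; the residue u in {1..k} of i mod k is used.\<close>
definition cb_entry :: "nat \<Rightarrow> (nat \<Rightarrow> real) \<Rightarrow> (nat \<Rightarrow> nat \<Rightarrow> real) \<Rightarrow> nat \<Rightarrow> nat \<Rightarrow> real" where
  "cb_entry k W a i j =
     (if i mod k = j mod k then W (if i mod k = 0 then k else i mod k)
      else if i < j then a i j else a j i)"

text \<open>The N x N checkerboard matrix (Jordan_Normal_Form indices are 0-based, so shift by 1).\<close>
definition checkerboard_matrix :: "nat \<Rightarrow> (nat \<Rightarrow> real) \<Rightarrow> (nat \<Rightarrow> nat \<Rightarrow> real) \<Rightarrow> nat \<Rightarrow> real mat" where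
  "checkerboard_matrix k W a N = mat N N (\<lambda>(i, j). cb_entry k W a (i + 1) (j + 1))"

end

theory Submission
  imports Defs "Jordan_Normal_Form.Schur_Decomposition"
begin

text \<open>
  The checkerboard matrix is \<open>S + R\<close>, where \<open>S\<close> is constant on the residue classes modulo \<open>k\<close> and
  the random part \<open>R\<close> vanishes on the pattern. The spectrum of \<open>S\<close> is explicit: \<open>0\<close> with multiplicity
  \<open>N - k\<close>, and \<open>w\<^sub>u\<close> times the size of the class of \<open>u\<close>, which is \<open>N/k + O(1)\<close>. By Weyl's inequality,
  the sorted eigenvalues of \<open>S + R\<close> and of \<open>S\<close> differ by at most the operator norm of \<open>R\<close>.

  That norm is controlled by the moment method: \<open>tr R\<^sup>2\<^sup>m\<close> is a sum over closed walks of length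
  \<open>2m\<close>. Since the entries are independent and centred, only walks traversing each of their edges at
  least twice contribute in expectation; these visit at most \<open>m + 1\<close> vertices, so that
  \<open>E tr R\<^sup>2\<^sup>m = O(N\<^sup>m\<^sup>+\<^sup>1)\<close>. Choosing \<open>m\<close> with \<open>2m\<epsilon> \<ge> 3\<close> makes
  \<open>E tr R\<^sup>2\<^sup>m / N\<^bsup>2m(1/2+\<epsilon>)\<^esup>\<close> summable over \<open>N\<close>, so almost surely the operator norm is
  \<open>O(N\<^bsup>1/2+\<epsilon>\<^esup>)\<close>.
\<close>

unbundle no vec_syntax and no inner_syntax

section \<open>Real symmetric matrices\<close>

text \<open>Over the complex numbers the polynomial splits. For an eigenvector \<open>z\<close> with
  eigenvalue \<open>e\<close>, symmetry lets \<open>?B\<close> act on either factor of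
  \<open>conjugate z \<bullet> z\<close>, and the two evaluations force \<open>e\<close> to equal
  its conjugate. The factorisation then descends because the coefficient embedding is
  injective.\<close>

lemma symmetric_char_poly_splits:
  fixes A :: "real mat"
  assumes A: "A \<in> carrier_mat n n" and sym: "transpose_mat A = A"
  shows "\<exists>es. char_poly A = (\<Prod>e\<leftarrow>es. [:- e, 1:])"
proof -
  let ?B = "map_mat complex_of_real A"
  have B: "?B \<in> carrier_mat n n" using A by simp
  obtain es where es: "char_poly ?B = (\<Prod>e\<leftarrow>es. [:- e, 1:])"
    using char_poly_factorized[OF B] by blast
  have real: "e \<in> \<real>" if "e \<in> set es" for e
  proof -
    have "poly (char_poly ?B) e = 0"
      unfolding es using that by (induction es) auto
    then have "eigenvalue ?B e" using eigenvalue_root_char_poly[OF B] by simp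
    then obtain z where z: "z \<in> carrier_vec n" "z \<noteq> 0\<^sub>v n" "?B *\<^sub>v z = e \<cdot>\<^sub>v z"
      using B unfolding eigenvalue_def eigenvector_def by auto
    have zc: "conjugate z \<in> carrier_vec n" using z by simp
    have Bt: "transpose_mat ?B = ?B"
      using sym by (metis map_mat_transpose)
    have cB: "?B *\<^sub>v conjugate z = conjugate e \<cdot>\<^sub>v conjugate z"
    proof -
      have "?B *\<^sub>v conjugate z = conjugate (?B *\<^sub>v z)"
        using A z(1) by (intro eq_vecI) (auto simp: scalar_prod_def)
      then show ?thesis using z by (simp add: conjugate_smult_vec)
    qed
    have "e * (conjugate z \<bullet> z) = conjugate z \<bullet> (?B *\<^sub>v z)"
      using z zc by simp
    also have "\<dots> = conjugate e * (conjugate z \<bullet> z)"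
      using z zc transpose_vec_mult_scalar[OF B z(1) zc, symmetric] unfolding Bt cB by simp
    finally have "e = conjugate e \<or> conjugate z \<bullet> z = 0" by auto
    moreover have "conjugate z \<bullet> z \<noteq> 0"
      using z(1,2) by (metis conjugate_square_eq_0_vec conjugate_vec_sprod_comm zc)
    ultimately show ?thesis
      by (simp add: Complex.Reals_cnj_iff)
  qed
  define rs where "rs = map Re es"
  have es': "es = map complex_of_real rs"
    unfolding rs_def using real by (auto simp: comp_def intro!: map_idI[symmetric])
  interpret map_poly_inj_comm_ring_hom complex_of_real ..
  have "map_poly complex_of_real (char_poly A) = char_poly ?B"
    by (rule of_real_hom.char_poly_hom[OF A, symmetric])
  also have "\<dots> = map_poly complex_of_real (\<Prod>e\<leftarrow>rs. [:- e, 1:])"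
    unfolding es es' by (simp add: hom_prod_list comp_def)
  finally show ?thesis
    using injectivity by blast
qed

text \<open>Gram-Schmidt applied to a basis that starts with \<open>v\<close> keeps \<open>v\<close>
  as its first vector; normalising the result gives orthonormal columns, and turns \<open>v\<close>
  into a multiple of itself.\<close>

lemma orthogonal_extension:
  fixes v :: "real vec"
  assumes v: "v \<in> carrier_vec n" "v \<noteq> 0\<^sub>v n"
  shows "\<exists>W \<in> carrier_mat n n. \<exists>c. transpose_mat W * W = 1\<^sub>m n \<and> col W 0 = c \<cdot>\<^sub>v v"
proof -
  interpret cof_vec_space n "TYPE(real)" .
  define b where "b = basis_completion v"
  define ws where "ws = gram_schmidt n b"
  from basis_completion[OF v, folded b_def]
  have dist_b: "distinct b" and indep: "\<not> lin_dep (set b)" and b: "set b \<subseteq> carrier_vec n"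
    and hdb: "hd b = v" and len_b: "length b = n" by auto
  have n: "n \<noteq> 0" using v by auto
  with hdb len_b obtain vs where bv: "b = v # vs" by (cases b) auto
  from gram_schmidt_result[OF b dist_b indep refl, folded ws_def]
  have ws: "set ws \<subseteq> carrier_vec n" "corthogonal ws" "length ws = n" by (auto simp: len_b)
  have "hd ws = v" using gram_schmidt_hd[OF v(1), of vs, folded bv] unfolding ws_def .
  then have ws0: "ws ! 0 = v" using ws(3) n by (cases ws) auto
  have wsc: "ws ! i \<in> carrier_vec n" if "i < n" for i using ws that by auto
  have orth: "ws ! i \<bullet> ws ! j = 0 \<longleftrightarrow> i \<noteq> j" if "i < n" "j < n" for i j
    using corthogonalD[OF ws(2), of i j] that ws(3) by simp
  have pos: "ws ! i \<bullet> ws ! i > 0" if "i < n" for i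
    using orth[OF that that] by (simp add: scalar_prod_def sum_nonneg order_less_le)
  define s where "s i = 1 / sqrt (ws ! i \<bullet> ws ! i)" for i
  define W where "W = mat_of_cols n (map (\<lambda>i. s i \<cdot>\<^sub>v ws ! i) [0..<n])"
  have W: "W \<in> carrier_mat n n" unfolding W_def using mat_of_cols_carrier(1)[of n "map (\<lambda>i. s i \<cdot>\<^sub>v ws ! i) [0..<n]"] by simp
  have colW: "col W i = s i \<cdot>\<^sub>v ws ! i" if "i < n" for i
    unfolding W_def using that wsc[OF that] by (subst col_mat_of_cols) auto
  have "transpose_mat W * W = 1\<^sub>m n"
  proof (rule eq_matI)
    fix i j assume ij: "i < dim_row (1\<^sub>m n)" "j < dim_col (1\<^sub>m n)"
    then have ij: "i < n" "j < n" by auto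
    have "(transpose_mat W * W) $$ (i, j) = s i * s j * (ws ! i \<bullet> ws ! j)"
      using ij W wsc[OF ij(1)] wsc[OF ij(2)] by (simp add: colW)
    also have "\<dots> = (1\<^sub>m n) $$ (i, j)"
      using ij orth[OF ij] pos[OF ij(1)] by (auto simp: s_def real_div_sqrt field_simps)
    finally show "(transpose_mat W * W) $$ (i, j) = (1\<^sub>m n) $$ (i, j)" .
  qed (use W in auto)
  moreover have "col W 0 = s 0 \<cdot>\<^sub>v v" using colW[of 0] n ws0 by simp
  ultimately show ?thesis using W by blast
qed

text \<open>Deflation: in an orthonormal basis that starts with an eigenvector for the first root,
  \<open>A\<close> becomes block diagonal, and the induction continues with the remaining block.
  Since \<open>es\<close> may be any ordering of the roots, the diagonal comes out in any prescribed
  order; Weyl's inequality takes the increasing one.\<close>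

theorem symmetric_diagonalization:
  fixes A :: "real mat"
  assumes "A \<in> carrier_mat n n" "transpose_mat A = A"
    and "char_poly A = (\<Prod>e\<leftarrow>es. [:- e, 1:])"
  shows "\<exists>U \<in> carrier_mat n n. transpose_mat U * U = 1\<^sub>m n
            \<and> transpose_mat U * A * U = mat_diag n (\<lambda>i. es ! i)"
  using assms
proof (induction es arbitrary: n A)
  case Nil
  then have "n = 0" using degree_monic_char_poly[of A n] by simp
  then show ?case using Nil by (intro bexI[of _ "1\<^sub>m 0"]) (auto simp: mat_diag_def intro!: eq_matI)
next
  case (Cons e es)
  note A = Cons.prems(1) and sym = Cons.prems(2) and cp = Cons.prems(3)
  have "monic (\<Prod>e\<leftarrow>es. [:- e, 1:])" by (rule monic_prod_list) auto
  then have "degree (char_poly A) = Suc (degree (\<Prod>e\<leftarrow>es. [:- e, 1:]))"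
    unfolding cp by (simp add: degree_mult_eq del: mult_pCons_left) (subst degree_mult_eq, auto)
  then obtain m where n: "n = Suc m" using degree_monic_char_poly[OF A] by auto
  have "eigenvalue A e" unfolding eigenvalue_root_char_poly[OF A] cp by simp
  then obtain v where v: "v \<in> carrier_vec n" "v \<noteq> 0\<^sub>v n" "A *\<^sub>v v = e \<cdot>\<^sub>v v"
    using A unfolding eigenvalue_def eigenvector_def by auto
  obtain W c where W: "W \<in> carrier_mat n n" and WW: "transpose_mat W * W = 1\<^sub>m n"
    and col0: "col W 0 = c \<cdot>\<^sub>v v"
    using orthogonal_extension[OF v(1,2)] by blast
  let ?Wt = "transpose_mat W"
  have Wt: "?Wt \<in> carrier_mat n n" using W by simp
  have WW': "W * ?Wt = 1\<^sub>m n" using mat_mult_left_right_inverse[OF Wt W WW] .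
  define B where "B = ?Wt * A * W"
  have B: "B \<in> carrier_mat n n" using A W unfolding B_def by simp
  have symB: "transpose_mat B = B"
    unfolding B_def using A W Wt sym
    by (simp add: transpose_mult[of _ n n _ n] assoc_mult_mat[of _ n n _ n _ n])
  \<comment> \<open>As \<open>col W 0\<close> is a multiple of the eigenvector, this column is
    \<open>e\<close> times the first unit vector; symmetry of \<open>B\<close> then clears the first
    row too.\<close>
  have "col B 0 = ?Wt *\<^sub>v (A *\<^sub>v col W 0)"
    unfolding B_def using A W Wt n by (auto simp: assoc_mult_mat[of _ n n _ n _ n] col_mult2[of _ n n _ n] mult_mat_vec_def)
  also have "\<dots> = e \<cdot>\<^sub>v (?Wt *\<^sub>v col W 0)"
    unfolding col0 using v A Wt
    by (simp add: mult_mat_vec[of _ n n] smult_smult_assoc mult.commute)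
  also have "?Wt *\<^sub>v col W 0 = col (1\<^sub>m n) 0"
    using W Wt n unfolding WW[symmetric] by (simp add: col_mult2[of _ n n _ n] mult_mat_vec_def)
  finally have colB: "B $$ (i, 0) = (if i = 0 then e else 0)" if "i < n" for i
    using that B n by (simp add: vec_eq_iff)
  have rowB: "B $$ (0, j) = (if j = 0 then e else 0)" if "j < n" for j
    using colB[OF that] that B n by (metis carrier_matD index_transpose_mat(1) symB zero_less_Suc)
  have Bs: "B $$ (i, j) = B $$ (j, i)" if "i < n" "j < n" for i j
    using symB B that by (metis carrier_matD index_transpose_mat(1))
  define C where "C = mat m m (\<lambda>(i, j). B $$ (Suc i, Suc j))"
  have C: "C \<in> carrier_mat m m" unfolding C_def by simp
  define E where "E = mat 1 1 (\<lambda>(i::nat, j::nat). e)"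
  have E: "E \<in> carrier_mat 1 1" unfolding E_def by simp
  have BC: "B = four_block_mat E (0\<^sub>m 1 m) (0\<^sub>m m 1) C"
    using B n colB rowB by (intro eq_matI) (auto simp: E_def C_def)
  have symC: "transpose_mat C = C"
  proof (rule eq_matI)
    fix i j assume "i < dim_row C" "j < dim_col C"
    then have "i < m" "j < m" using C by auto
    then show "transpose_mat C $$ (i, j) = C $$ (i, j)"
      using Bs[of "Suc j" "Suc i"] n by (simp add: C_def)
  qed (use C in auto)
  have "similar_mat A B"
  proof (rule similar_matI)
    show "{A, B, W, ?Wt} \<subseteq> carrier_mat n n" using A B W by auto
    have "W * B * ?Wt = W * ?Wt * A * (W * ?Wt)"
      unfolding B_def using A W Wt by (simp add: assoc_mult_mat[of _ n n _ n _ n])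
    then show "A = W * B * ?Wt" using A WW' by simp
  qed (use WW WW' in auto)
  then have "char_poly A = char_poly E * char_poly C"
    unfolding BC using char_poly_similar char_poly_four_block_zeros_col[OF E _ C, of "0\<^sub>m 1 m"] by fastforce
  moreover have "char_poly E = [:- e, 1:]"
    by (simp add: E_def char_poly_defs det_def sign_def)
  ultimately have "[:- e, 1:] * char_poly C = [:- e, 1:] * (\<Prod>e\<leftarrow>es. [:- e, 1:])"
    using cp by simp
  then have "char_poly C = (\<Prod>e\<leftarrow>es. [:- e, 1:])"
    unfolding mult_cancel_left by simp
  from Cons.IH[OF C symC this] obtain V where V: "V \<in> carrier_mat m m"
    and VV: "transpose_mat V * V = 1\<^sub>m m" and VC: "transpose_mat V * C * V = mat_diag m (\<lambda>i. es ! i)"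
    by blast
  \<comment> \<open>Extending \<open>V\<close> by a 1 in the corner makes \<open>W * F\<close>
    perform both changes of basis at once.\<close>
  define F where "F = four_block_mat (1\<^sub>m 1) (0\<^sub>m 1 m) (0\<^sub>m m 1) V"
  have F: "F \<in> carrier_mat n n" unfolding F_def n using four_block_carrier_mat[of "1\<^sub>m 1" 1 1 V m m] V by simp
  have Ft: "transpose_mat F = four_block_mat (1\<^sub>m 1) (0\<^sub>m 1 m) (0\<^sub>m m 1) (transpose_mat V)"
    unfolding F_def using V by (subst transpose_four_block_mat) auto
  have FF: "transpose_mat F * F = 1\<^sub>m n"
    unfolding Ft unfolding F_def using V VV n
    by (subst mult_four_block_mat[of _ 1 1 _ m _ m _ _ 1 _ m]) auto
  have "transpose_mat F * B = four_block_mat E (0\<^sub>m 1 m) (0\<^sub>m m 1) (transpose_mat V * C)"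
    unfolding Ft BC using V C E
    by (subst mult_four_block_mat[of _ 1 1 _ m _ m _ _ 1 _ m]) auto
  then have "transpose_mat F * B * F = four_block_mat E (0\<^sub>m 1 m) (0\<^sub>m m 1) (transpose_mat V * C * V)"
    unfolding F_def using V C E
    by (simp only:) (subst mult_four_block_mat[of _ 1 1 _ m _ m _ _ 1 _ m], auto)
  also have "\<dots> = mat_diag n (\<lambda>i. (e # es) ! i)"
    unfolding VC n by (intro eq_matI) (auto simp: E_def mat_diag_def nth_Cons')
  finally have FBF: "transpose_mat F * B * F = mat_diag n (\<lambda>i. (e # es) ! i)" .
  have Ft': "transpose_mat F \<in> carrier_mat n n" using F by simp
  have tWF: "transpose_mat (W * F) = transpose_mat F * ?Wt" using W F by (rule transpose_mult)
  have "transpose_mat (W * F) * (W * F) = transpose_mat F * (?Wt * W) * F"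
    unfolding tWF using W F Wt Ft' by (simp add: assoc_mult_mat[of _ n n _ n _ n])
  then have 1: "transpose_mat (W * F) * (W * F) = 1\<^sub>m n" using WW F Ft' FF by simp
  have "transpose_mat (W * F) * A * (W * F) = transpose_mat F * B * F"
    unfolding tWF B_def using W F Wt Ft' A by (simp add: assoc_mult_mat[of _ n n _ n _ n])
  with 1 FBF show ?case using W F by (intro bexI[of _ "W * F"]) auto
qed

section \<open>Weyl's inequality by quadratic forms\<close>

lemma orthogonal_scalar_prod:
  fixes U :: "real mat"
  assumes U: "U \<in> carrier_mat n n" "transpose_mat U * U = 1\<^sub>m n"
    and x: "x \<in> carrier_vec n" and y: "y \<in> carrier_vec n"
  shows "(U *\<^sub>v y) \<bullet> (U *\<^sub>v x) = y \<bullet> x"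
proof -
  have Uy: "U *\<^sub>v y \<in> carrier_vec n" using U y by simp
  have "(U *\<^sub>v y) \<bullet> (U *\<^sub>v x) = (transpose_mat U *\<^sub>v (U *\<^sub>v y)) \<bullet> x"
    by (rule transpose_vec_mult_scalar[OF U(1) x Uy, symmetric])
  also have "transpose_mat U *\<^sub>v (U *\<^sub>v y) = (transpose_mat U * U) *\<^sub>v y"
    using U y by (intro assoc_mult_mat_vec[symmetric, of _ n n _ n]) auto
  finally show ?thesis using U y by simp
qed

lemma quadratic_form_diagonalized:
  fixes A U :: "real mat"
  assumes A: "A \<in> carrier_mat n n" and U: "U \<in> carrier_mat n n"
    and D: "transpose_mat U * A * U = mat_diag n d" and c: "c \<in> carrier_vec n"
  shows "(U *\<^sub>v c) \<bullet> (A *\<^sub>v (U *\<^sub>v c)) = (\<Sum>i<n. d i * (c $ i)\<^sup>2)"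
proof -
  have "(U *\<^sub>v c) \<bullet> (A *\<^sub>v (U *\<^sub>v c)) = (A *\<^sub>v (U *\<^sub>v c)) \<bullet> (U *\<^sub>v c)"
    using A U c by (intro comm_scalar_prod[of _ n]) auto
  also have "\<dots> = (transpose_mat U *\<^sub>v (A *\<^sub>v (U *\<^sub>v c))) \<bullet> c"
    using A U c by (intro transpose_vec_mult_scalar[symmetric, of _ n n]) auto
  also have "transpose_mat U *\<^sub>v (A *\<^sub>v (U *\<^sub>v c)) = mat_diag n d *\<^sub>v c"
    unfolding D[symmetric] using A U c by (simp add: assoc_mult_mat_vec[of _ n n _ n])
  also have "\<dots> \<bullet> c = (\<Sum>i<n. (\<Sum>j<n. (if i = j then d j else 0) * c $ j) * c $ i)"
    using c by (simp add: scalar_prod_def mat_diag_def atLeast0LessThan)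
  also have "\<dots> = (\<Sum>i<n. d i * (c $ i)\<^sup>2)"
    by (intro sum.cong refl) (simp add: if_distrib[of "\<lambda>z. z * _"] power2_eq_square cong: if_cong)
  finally show ?thesis .
qed

lemma scalar_prod_self: "c \<in> carrier_vec n \<Longrightarrow> c \<bullet> c = (\<Sum>i<n. (c $ i :: real)\<^sup>2)"
  by (simp add: scalar_prod_def power2_eq_square atLeast0LessThan)

text \<open>The vector realising the Courant-Fischer bound lies in the span of the top eigenvectors of
  \<^term>\<open>A\<close> and the bottom eigenvectors of \<^term>\<open>B\<close>. It exists because the two spans together have
  dimension exceeding \<^term>\<open>n\<close>; the corresponding linear system is made square by a zero row.\<close>

theorem weyl_upper:
  fixes A B U V :: "real mat"
  assumes A: "A \<in> carrier_mat n n" and B: "B \<in> carrier_mat n n"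
    and U: "U \<in> carrier_mat n n" "transpose_mat U * U = 1\<^sub>m n" "transpose_mat U * A * U = mat_diag n a"
    and V: "V \<in> carrier_mat n n" "transpose_mat V * V = 1\<^sub>m n" "transpose_mat V * B * V = mat_diag n b"
    and a: "\<And>i j. i \<le> j \<Longrightarrow> j < n \<Longrightarrow> a i \<le> a j"
    and b: "\<And>i j. i \<le> j \<Longrightarrow> j < n \<Longrightarrow> b i \<le> b j"
    and \<rho>: "\<And>x. x \<in> carrier_vec n \<Longrightarrow> x \<bullet> (A *\<^sub>v x) \<le> x \<bullet> (B *\<^sub>v x) + \<rho> * (x \<bullet> x)"
    and i: "i < n"
  shows "a i \<le> b i + \<rho>"
proof -
  \<comment> \<open>\<open>T\<close> converts coordinates in the eigenbasis of \<open>A\<close> into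
    coordinates in that of \<open>B\<close>. The unit rows below index \<open>i\<close> exclude the
    lower eigenvectors of \<open>A\<close>, and the rows of \<open>T\<close> above index
    \<open>i\<close> exclude the upper eigenvectors of \<open>B\<close>.\<close>
  define T where "T = transpose_mat V * U"
  have T: "T \<in> carrier_mat n n" unfolding T_def using U V by simp
  define r where "r j = (if j < i then unit_vec n j else Matrix.row T j)" for j
  define Z where "Z = mat\<^sub>r n n (\<lambda>j. if j = i then 0\<^sub>v n else r j)"
  have Z: "Z \<in> carrier_mat n n" unfolding Z_def by simp
  have "det Z = 0"
    unfolding Z_def using i T by (intro det_row_0) (auto simp: r_def)
  then obtain c where c: "c \<in> carrier_vec n" "c \<noteq> 0\<^sub>v n" "Z *\<^sub>v c = 0\<^sub>v n"
    using det_0_iff_vec_prod_zero[OF Z] by blast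
  have rc: "r j \<bullet> c = 0" if "j < n" "j \<noteq> i" for j
  proof -
    have "(Z *\<^sub>v c) $ j = r j \<bullet> c"
      using that T c(1) by (simp add: Z_def row_mat_of_row_fun r_def)
    then show ?thesis using c(3) that by simp
  qed
  have c0: "c $ j = 0" if "j < i" for j
    using rc[of j] that i c(1) by (simp add: r_def)
  define d where "d = T *\<^sub>v c"
  have d: "d \<in> carrier_vec n" unfolding d_def using T c by simp
  have d0: "d $ j = 0" if "i < j" "j < n" for j
    using rc[of j] that T by (simp add: r_def d_def)
  define x where "x = U *\<^sub>v c"
  have x: "x \<in> carrier_vec n" unfolding x_def using U c by simp
  have VV: "V * transpose_mat V = 1\<^sub>m n"
    using mat_mult_left_right_inverse[OF _ V(1) V(2)] V(1) by simp
  have xd: "x = V *\<^sub>v d"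
  proof -
    have "V *\<^sub>v d = (V * transpose_mat V) *\<^sub>v x"
      unfolding d_def T_def x_def using U V c by (simp add: assoc_mult_mat_vec[of _ n n _ n] assoc_mult_mat[of _ n n _ n _ n])
    then show ?thesis using VV x by simp
  qed
  have xx: "x \<bullet> x = c \<bullet> c" "x \<bullet> x = d \<bullet> d"
    using orthogonal_scalar_prod[OF U(1,2) c(1) c(1)] orthogonal_scalar_prod[OF V(1,2) d d]
    unfolding x_def[symmetric] xd[symmetric] by auto
  have pos: "x \<bullet> x > 0"
  proof -
    obtain j where j: "j < n" "c $ j \<noteq> 0" using c(1,2) by (auto simp: vec_eq_iff)
    have "0 < (c $ j)\<^sup>2" using j by simp
    also have "\<dots> \<le> (\<Sum>j<n. (c $ j)\<^sup>2)" using j by (intro member_le_sum) auto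
    finally show ?thesis unfolding xx(1) scalar_prod_self[OF c(1)] .
  qed
  \<comment> \<open>All coordinates of \<open>c\<close> below \<open>i\<close> vanish, so the form
    of \<open>A\<close> at \<open>x\<close> is at least \<open>a i\<close> times the squared norm;
    dually \<open>d\<close> vanishes above \<open>i\<close>, so the form of \<open>B\<close> is at
    most \<open>b i\<close> times it.\<close>
  have "a i * (x \<bullet> x) = (\<Sum>j<n. a i * (c $ j)\<^sup>2)"
    unfolding xx(1) scalar_prod_self[OF c(1)] by (simp add: sum_distrib_left)
  also have "\<dots> \<le> (\<Sum>j<n. a j * (c $ j)\<^sup>2)"
  proof (rule sum_mono)
    fix j assume "j \<in> {..<n}"
    then show "a i * (c $ j)\<^sup>2 \<le> a j * (c $ j)\<^sup>2"
      using c0[of j] a[of i j] by (cases "j < i") (auto intro: mult_right_mono)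
  qed
  also have "\<dots> = x \<bullet> (A *\<^sub>v x)"
    unfolding x_def using quadratic_form_diagonalized[OF A U(1,3) c(1)] by simp
  also have "\<dots> \<le> x \<bullet> (B *\<^sub>v x) + \<rho> * (x \<bullet> x)" by (rule \<rho>[OF x])
  also have "x \<bullet> (B *\<^sub>v x) = (\<Sum>j<n. b j * (d $ j)\<^sup>2)"
    unfolding xd using quadratic_form_diagonalized[OF B V(1,3) d] by simp
  also have "\<dots> \<le> (\<Sum>j<n. b i * (d $ j)\<^sup>2)"
  proof (rule sum_mono)
    fix j assume "j \<in> {..<n}"
    then show "b j * (d $ j)\<^sup>2 \<le> b i * (d $ j)\<^sup>2"
      using d0[of j] b[of j i] i by (cases "i < j") (auto intro: mult_right_mono)
  qed
  also have "\<dots> = b i * (x \<bullet> x)"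
    unfolding xx(2) scalar_prod_self[OF d] by (simp add: sum_distrib_left)
  finally have "a i * (x \<bullet> x) \<le> (b i + \<rho>) * (x \<bullet> x)" by (simp add: algebra_simps)
  then show ?thesis using pos by simp
qed

lemma weyl:
  fixes A B U V :: "real mat"
  assumes A: "A \<in> carrier_mat n n" and B: "B \<in> carrier_mat n n"
    and U: "U \<in> carrier_mat n n" "transpose_mat U * U = 1\<^sub>m n" "transpose_mat U * A * U = mat_diag n a"
    and V: "V \<in> carrier_mat n n" "transpose_mat V * V = 1\<^sub>m n" "transpose_mat V * B * V = mat_diag n b"
    and a: "\<And>i j. i \<le> j \<Longrightarrow> j < n \<Longrightarrow> a i \<le> a j"
    and b: "\<And>i j. i \<le> j \<Longrightarrow> j < n \<Longrightarrow> b i \<le> b j"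
    and \<rho>: "\<And>x. x \<in> carrier_vec n \<Longrightarrow> \<bar>x \<bullet> (A *\<^sub>v x) - x \<bullet> (B *\<^sub>v x)\<bar> \<le> \<rho> * (x \<bullet> x)"
    and i: "i < n"
  shows "\<bar>a i - b i\<bar> \<le> \<rho>"
proof -
  have \<rho>': "x \<bullet> (A *\<^sub>v x) \<le> x \<bullet> (B *\<^sub>v x) + \<rho> * (x \<bullet> x)"
    "x \<bullet> (B *\<^sub>v x) \<le> x \<bullet> (A *\<^sub>v x) + \<rho> * (x \<bullet> x)" if "x \<in> carrier_vec n" for x
    using \<rho>[OF that] by linarith+
  have "a i \<le> b i + \<rho>" by (rule weyl_upper[OF A B U V a b \<rho>'(1) i])
  moreover have "b i \<le> a i + \<rho>" by (rule weyl_upper[OF B A V U b a \<rho>'(2) i])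
  ultimately show ?thesis by linarith
qed

section \<open>Matrices constant on colour classes\<close>

lemma char_poly_block_lower_triangular:
  fixes A :: "'a::idom mat"
  assumes A: "A \<in> carrier_mat n n" and C: "C \<in> carrier_mat m n" and D: "D \<in> carrier_mat m m"
  shows "char_poly (four_block_mat A (0\<^sub>m n m) C D) = char_poly A * char_poly D"
proof -
  have "char_poly_matrix (four_block_mat A (0\<^sub>m n m) C D)
      = four_block_mat (char_poly_matrix A) (0\<^sub>m n m) (map_mat (\<lambda>a. [:- a:]) C) (char_poly_matrix D)"
    using assms by (intro eq_matI) (auto simp: char_poly_matrix_def one_poly_def)
  then show ?thesis
    unfolding char_poly_def using assms by (simp add: det_four_block_mat_upper_right_zero[of _ n _ m])
qed

lemma char_poly_zero_mat: "char_poly (0\<^sub>m n n :: 'a::idom mat) = monom 1 n"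
proof -
  have "char_poly (0\<^sub>m n n :: 'a mat) = (\<Prod>a\<leftarrow>diag_mat (0\<^sub>m n n :: 'a mat). [:- a, 1:])"
    by (rule char_poly_upper_triangular[of _ n]) auto
  also have "diag_mat (0\<^sub>m n n :: 'a mat) = replicate n 0"
    by (auto simp: diag_mat_def intro!: nth_equalityI)
  also have "(\<Prod>a\<leftarrow>replicate n (0::'a). [:- a, 1:]) = monom 1 n"
    by (simp add: monom_altdef)
  finally show ?thesis .
qed

text \<open>Both \<^term>\<open>A * B\<close> and \<^term>\<open>B * A\<close> are corners of similar block-triangular matrices.\<close>

theorem char_poly_mult_commute:
  fixes A B :: "'a::idom mat"
  assumes A: "A \<in> carrier_mat n m" and B: "B \<in> carrier_mat m n"
  shows "char_poly (A * B) * monom 1 m = monom 1 n * char_poly (B * A)"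
proof -
  let ?P = "four_block_mat (1\<^sub>m n) A (0\<^sub>m m n) (1\<^sub>m m)"
  let ?Q = "four_block_mat (1\<^sub>m n) (- A) (0\<^sub>m m n) (1\<^sub>m m)"
  let ?L = "four_block_mat (A * B) (0\<^sub>m n m) B (0\<^sub>m m m)"
  let ?R = "four_block_mat (0\<^sub>m n n) (0\<^sub>m n m) B (B * A)"
  have one: "1\<^sub>m (n + m) = four_block_mat (1\<^sub>m n) (0\<^sub>m n m) (0\<^sub>m m n) (1\<^sub>m m)"
    by (rule eq_matI) auto
  have A0: "A + - A = 0\<^sub>m n m" "- A + A = 0\<^sub>m n m" "- 0\<^sub>m m m + 1\<^sub>m m = (1\<^sub>m m :: 'a mat)"
    using A by (auto intro!: eq_matI)
  have AB: "A * B \<in> carrier_mat n n" and BA: "B * A \<in> carrier_mat m m" using A B by auto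
  have mA: "- A \<in> carrier_mat n m" using A by simp
  have PR: "?P * ?R = four_block_mat (A * B) (A * (B * A)) B (B * A)"
    using A B AB BA by (subst mult_four_block_mat[of _ n n _ m _ m _ _ n _ m]) auto
  have "similar_mat ?L ?R"
  proof (rule similar_matI)
    show "{?L, ?R, ?P, ?Q} \<subseteq> carrier_mat (n + m) (n + m)"
      using A B AB BA by auto
    show "?P * ?Q = 1\<^sub>m (n + m)"
      unfolding one using A mA by (subst mult_four_block_mat[of _ n n _ m _ m _ _ n _ m]) (auto simp: A0)
    show "?Q * ?P = 1\<^sub>m (n + m)"
      unfolding one using A mA by (subst mult_four_block_mat[of _ n n _ m _ m _ _ n _ m]) (auto simp: A0)
    \<comment> \<open>By associativity the right-hand blocks cancel after conjugation, which leaves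
      \<open>A * B\<close> as the only nonzero diagonal block.\<close>
    have "A * B * - A + A * (B * A) = 0\<^sub>m n m" "B * - A + B * A = 0\<^sub>m m m"
      using A B AB BA mA by (simp_all add: assoc_mult_mat[of A n m B n A m])
    then show "?L = ?P * ?R * ?Q"
      unfolding PR using A B AB BA mA
      by (subst mult_four_block_mat[of _ n n _ m _ m _ _ n _ m]) auto
  qed
  then have "char_poly ?L = char_poly ?R" by (rule char_poly_similar)
  then show ?thesis
    using A B AB BA
    by (simp add: char_poly_block_lower_triangular[of _ n _ m] char_poly_zero_mat)
qed

text \<open>The matrix factors through dimension \<open>k\<close> as \<open>A * B\<close>, with
  \<open>A\<close> the weighted and \<open>B\<close> the plain indicator matrix of the classes. In
  the opposite order the product is diagonal, with weight times class size as entries, and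
  exchanging the factors costs only \<open>N - k\<close> zeros.\<close>

lemma char_poly_block_constant:
  fixes w :: "nat \<Rightarrow> 'a::idom"
  assumes f: "\<And>i. i < N \<Longrightarrow> f i < k" and N: "k \<le> N"
  shows "char_poly (mat N N (\<lambda>(i, j). if f i = f j then w (f i) else 0))
       = (\<Prod>e\<leftarrow>replicate (N - k) 0 @ map (\<lambda>r. w r * of_nat (card {i. i < N \<and> f i = r})) [0..<k]. [:- e, 1:])"
    (is "char_poly ?S = _")
proof -
  define A where "A = mat N k (\<lambda>(i, r). if f i = r then w r else 0)"
  define B where "B = mat k N (\<lambda>(r, j). if f j = r then 1 else (0::'a))"
  let ?\<mu> = "\<lambda>r. w r * of_nat (card {i. i < N \<and> f i = r})"
  have A: "A \<in> carrier_mat N k" and B: "B \<in> carrier_mat k N" unfolding A_def B_def by auto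
  have AB: "A * B = ?S"
    using f by (intro eq_matI)
      (auto simp: A_def B_def scalar_prod_def if_distrib[of "\<lambda>z. z * _"] sum.delta cong: if_cong)
  have BA: "B * A = mat_diag k ?\<mu>"
  proof (rule eq_matI)
    fix r s assume "r < dim_row (mat_diag k ?\<mu>)" "s < dim_col (mat_diag k ?\<mu>)"
    then have rs: "r < k" "s < k" by (auto simp: mat_diag_def)
    have "(B * A) $$ (r, s) = (\<Sum>i<N. if f i = r \<and> f i = s then w s else 0)"
      using rs by (auto simp: A_def B_def scalar_prod_def atLeast0LessThan intro!: sum.cong)
    also have "\<dots> = mat_diag k ?\<mu> $$ (r, s)"
    proof (cases "r = s")
      case True
      have "(\<Sum>i<N. if f i = s then w s else 0) = (\<Sum>i \<in> {i. i < N \<and> f i = s}. w s)"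
        by (intro sum.mono_neutral_cong_right) auto
      then show ?thesis using rs True by (simp add: mat_diag_def)
    qed (use rs in \<open>auto simp: mat_diag_def intro!: sum.neutral\<close>)
    finally show "(B * A) $$ (r, s) = mat_diag k ?\<mu> $$ (r, s)" .
  qed (auto simp: A_def B_def mat_diag_def)
  have "char_poly (B * A) = (\<Prod>e\<leftarrow>diag_mat (mat_diag k ?\<mu>). [:- e, 1:])"
    unfolding BA by (rule char_poly_upper_triangular[of _ k]) (auto simp: mat_diag_def)
  also have "diag_mat (mat_diag k ?\<mu>) = map ?\<mu> [0..<k]"
    by (auto simp: diag_mat_def mat_diag_def)
  finally have cBA: "char_poly (B * A) = (\<Prod>e\<leftarrow>map ?\<mu> [0..<k]. [:- e, 1:])" .
  have "monom (1::'a) N = monom 1 (N - k) * monom 1 k"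
    using N by (simp add: mult_monom)
  moreover have "(\<Prod>e\<leftarrow>replicate (N - k) (0::'a). [:- e, 1:]) = monom 1 (N - k)"
    by (simp add: monom_altdef)
  ultimately have "char_poly ?S * monom 1 k
      = (\<Prod>e\<leftarrow>replicate (N - k) 0 @ map ?\<mu> [0..<k]. [:- e, 1:]) * monom 1 k"
    using char_poly_mult_commute[OF A B] unfolding AB cBA by (simp add: mult_ac)
  then show ?thesis unfolding mult_cancel_right by simp
qed

text \<open>The quotient by \<open>k\<close> identifies each member of a residue class. Quotients
  are at most \<open>N div k\<close>, and conversely each of \<open>1, ..., (N - r) div k\<close> is
  attained.\<close>

lemma card_residue_class:
  assumes "k \<ge> 1" "r < k"
  shows "\<bar>real (card {i. i < N \<and> Suc i mod k = r}) - real N / real k\<bar> \<le> 2"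
proof -
  let ?S = "{i. i < N \<and> Suc i mod k = r}"
  have fin: "finite ?S" by simp
  have "card ?S \<le> card {..N div k}"
  proof (rule card_inj_on_le)
    show "inj_on (\<lambda>i. Suc i div k) ?S"
    proof (rule inj_onI)
      fix i j assume "i \<in> ?S" "j \<in> ?S" "Suc i div k = Suc j div k"
      then have "Suc i div k * k + Suc i mod k = Suc j div k * k + Suc j mod k" by simp
      then show "i = j" by (simp only: div_mult_mod_eq)
    qed
    show "(\<lambda>i. Suc i div k) ` ?S \<subseteq> {..N div k}" by (auto intro!: div_le_mono)
  qed simp
  then have "real (card ?S) \<le> real (N div k) + 1" by simp
  also have "real (N div k) \<le> real N / real k" by (rule of_nat_div_le_of_nat)
  finally have up: "real (card ?S) \<le> real N / real k + 1" by simp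
  \<comment> \<open>Starting at quotient 1 avoids the truncated subtraction in
    \<open>q * k + r - 1\<close> when \<open>q\<close> and \<open>r\<close> are both 0.\<close>
  have "card {1..(N - r) div k} \<le> card ?S"
  proof (rule card_inj_on_le)
    show "inj_on (\<lambda>q. q * k + r - 1) {1..(N - r) div k}"
    proof (rule inj_onI)
      fix p q assume *: "p \<in> {1..(N - r) div k}" "q \<in> {1..(N - r) div k}" "p * k + r - 1 = q * k + r - 1"
      then have "p * k \<ge> 1" "q * k \<ge> 1" using assms by auto
      with *(3) have "p * k = q * k" by linarith
      then show "p = q" using assms by simp
    qed
    show "(\<lambda>q. q * k + r - 1) ` {1..(N - r) div k} \<subseteq> ?S"
    proof
      fix i assume "i \<in> (\<lambda>q. q * k + r - 1) ` {1..(N - r) div k}"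
      then obtain q where q: "1 \<le> q" "q \<le> (N - r) div k" "i = q * k + r - 1" by auto
      have "q * k \<ge> 1" using q assms by auto
      moreover have "q * k \<le> (N - r) div k * k" using q by simp
      moreover have "(N - r) div k * k \<le> N - r" by simp
      ultimately have "Suc i = q * k + r" "i < N" using q by linarith+
      then show "i \<in> ?S" using assms by simp
    qed
  qed simp
  then have "real ((N - r) div k) \<le> real (card ?S)" by simp
  \<comment> \<open>Dropping \<open>r < k\<close> and rounding down each lose at most one block of
    length \<open>k\<close>, hence the constant 2.\<close>
  moreover have "real N / real k - 2 \<le> real ((N - r) div k)"
  proof -
    have "N - r < ((N - r) div k + 1) * k"
      using dividend_less_times_div[of k "N - r"] assms by (simp add: algebra_simps)
    then have "N < ((N - r) div k + 2) * k" using assms by simp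
    then have "real N < real (((N - r) div k + 2) * k)" by (simp only: of_nat_less_iff)
    then have "real N < (real ((N - r) div k) + 2) * real k" by (simp add: algebra_simps)
    then show ?thesis using assms by (simp add: field_simps)
  qed
  ultimately show ?thesis using up by linarith
qed

section \<open>Traces of powers as sums over closed walks\<close>

text \<open>\<open>L\<close> counts steps, so a walk has \<open>L + 1\<close> vertices.
  Extensionality makes each walk a single function and the set finite.\<close>

definition walks :: "nat \<Rightarrow> nat \<Rightarrow> (nat \<Rightarrow> nat) set" where
  "walks N L = {..L} \<rightarrow>\<^sub>E {..<N}"

lemma finite_walks [simp]: "finite (walks N L)"
  unfolding walks_def by (intro finite_PiE) auto

lemma pow_mat_walks:
  fixes R :: "'a::comm_semiring_1 mat"
  assumes R: "R \<in> carrier_mat N N" and "i < N" "j < N"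
  shows "(R ^\<^sub>m L) $$ (i, j) = (\<Sum>w | w \<in> walks N L \<and> w 0 = i \<and> w L = j. \<Prod>t<L. R $$ (w t, w (Suc t)))"
  using assms(3)
proof (induction L arbitrary: j)
  case 0
  have "{w. w \<in> walks N 0 \<and> w 0 = i \<and> w 0 = j} = (if i = j then {\<lambda>x\<in>{0}. i} else {})"
    using assms by (auto simp: walks_def PiE_def extensional_def restrict_def fun_eq_iff)
  then show ?case using R assms 0 by simp
next
  case (Suc L)
  let ?p = "\<lambda>L w. \<Prod>t<L. R $$ (w t, w (Suc t))"
  let ?W = "\<lambda>L j. {w. w \<in> walks N L \<and> w 0 = i \<and> w L = j}"
  have RL: "R ^\<^sub>m L \<in> carrier_mat N N" using R by simp
  have "(R ^\<^sub>m Suc L) $$ (i, j) = (\<Sum>l<N. (R ^\<^sub>m L) $$ (i, l) * R $$ (l, j))"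
    using R RL assms(2) Suc.prems by (simp add: scalar_prod_def atLeast0LessThan)
  also have "\<dots> = (\<Sum>l<N. \<Sum>w\<in>?W L l. ?p L w * R $$ (l, j))"
    using Suc.IH by (intro sum.cong) (simp_all add: sum_distrib_right)
  also have "\<dots> = (\<Sum>(l, w)\<in>(SIGMA l:{..<N}. ?W L l). ?p L w * R $$ (l, j))"
    by (intro sum.Sigma) auto
  also have "\<dots> = (\<Sum>w\<in>?W (Suc L) j. ?p (Suc L) w)"
  \<comment> \<open>A walk of \<open>Suc L\<close> steps ending in \<open>j\<close> corresponds to
    its first \<open>L\<close> steps; the intermediate endpoint \<open>l\<close> is recovered as
    \<open>w L\<close>.\<close>
  proof (rule sum.reindex_bij_witness[where i = "\<lambda>w. (w L, restrict w {..L})" and j = "\<lambda>(l, w). w(Suc L := j)"])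
    fix x assume x: "x \<in> (SIGMA l:{..<N}. ?W L l)"
    obtain l w where lw: "x = (l, w)" "l < N" "w \<in> walks N L" "w 0 = i" "w L = l" using x by auto
    show "(case x of (l, w) \<Rightarrow> w(Suc L := j)) \<in> ?W (Suc L) j"
      using lw Suc.prems by (auto simp: walks_def PiE_def Pi_def extensional_def)
    show "(\<lambda>w. (w L, restrict w {..L})) (case x of (l, w) \<Rightarrow> w(Suc L := j)) = x"
      using lw by (auto simp: walks_def PiE_def extensional_def fun_eq_iff restrict_def)
    show "?p (Suc L) (case x of (l, w) \<Rightarrow> w(Suc L := j)) = (case x of (l, w) \<Rightarrow> ?p L w * R $$ (l, j))"
      using lw by simp
  next
    fix w assume w: "w \<in> ?W (Suc L) j"
    show "(w L, restrict w {..L}) \<in> (SIGMA l:{..<N}. ?W L l)"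
      using w by (auto simp: walks_def PiE_def Pi_def)
    show "(case (w L, restrict w {..L}) of (l, w) \<Rightarrow> w(Suc L := j)) = w"
      using w by (auto simp: walks_def PiE_def extensional_def fun_eq_iff restrict_def le_Suc_eq)
  qed
  finally show ?case .
qed

lemma trace_mult_commute:
  fixes A B :: "'a::comm_semiring_0 mat"
  assumes "A \<in> carrier_mat n m" "B \<in> carrier_mat m n"
  shows "(\<Sum>i<n. (A * B) $$ (i, i)) = (\<Sum>i<m. (B * A) $$ (i, i))"
proof -
  have "(\<Sum>i<n. (A * B) $$ (i, i)) = (\<Sum>i<n. \<Sum>j<m. A $$ (i, j) * B $$ (j, i))"
    using assms by (simp add: scalar_prod_def atLeast0LessThan)
  also have "\<dots> = (\<Sum>j<m. \<Sum>i<n. A $$ (i, j) * B $$ (j, i))" by (rule sum.swap)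
  also have "\<dots> = (\<Sum>i<m. (B * A) $$ (i, i))"
    using assms by (simp add: scalar_prod_def atLeast0LessThan mult.commute)
  finally show ?thesis .
qed

text \<open>Both sides are the trace of the \<open>L\<close>-th power: one in the eigenbasis, using
  invariance of the trace under cyclic exchange, the other by expanding the diagonal entries into
  walks.\<close>

lemma sum_eigenvalue_powers:
  fixes R U :: "real mat"
  assumes R: "R \<in> carrier_mat n n"
    and U: "U \<in> carrier_mat n n" "transpose_mat U * U = 1\<^sub>m n" "transpose_mat U * R * U = mat_diag n d"
  shows "(\<Sum>j<n. d j ^ L) = (\<Sum>w | w \<in> walks n L \<and> w 0 = w L. \<Prod>t<L. R $$ (w t, w (Suc t)))"
proof -
  let ?Ut = "transpose_mat U"
  have Ut: "?Ut \<in> carrier_mat n n" using U by simp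
  have UU: "U * ?Ut = 1\<^sub>m n" by (rule mat_mult_left_right_inverse[OF Ut U(1,2)])
  have RL: "R ^\<^sub>m L \<in> carrier_mat n n" for L using R by simp
  have pow: "?Ut * R ^\<^sub>m L * U = mat_diag n (\<lambda>j. d j ^ L)" for L
  proof (induction L)
    case 0
    then show ?case using R U Ut by (simp add: mat_diag_one)
  next
    case (Suc L)
    define P where "P = R ^\<^sub>m L"
    have P: "P \<in> carrier_mat n n" unfolding P_def by (rule RL)
    have cancel: "U * (?Ut * (R * U)) = R * U"
      using R U(1) Ut assoc_mult_mat[OF U(1) Ut, of "R * U" n] by (simp add: UU left_mult_one_mat[of _ n n])
    have "?Ut * R ^\<^sub>m Suc L * U = (?Ut * P * U) * (?Ut * R * U)"
      using R P U(1) Ut by (simp add: assoc_mult_mat[of _ n n _ n _ n] cancel P_def[symmetric])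
    also have "\<dots> = mat_diag n (\<lambda>j. d j ^ Suc L)"
      unfolding P_def Suc.IH U(3) by (simp add: mat_diag_diag mult.commute)
    finally show ?case .
  qed
  have "(\<Sum>j<n. d j ^ L) = (\<Sum>j<n. (?Ut * R ^\<^sub>m L * U) $$ (j, j))"
    unfolding pow by (simp add: mat_diag_def)
  also have "\<dots> = (\<Sum>j<n. (U * (?Ut * R ^\<^sub>m L)) $$ (j, j))"
    using trace_mult_commute[of "?Ut * R ^\<^sub>m L" n n U] Ut U(1) RL[of L] by simp
  also have "U * (?Ut * R ^\<^sub>m L) = (U * ?Ut) * R ^\<^sub>m L"
    using Ut U(1) RL[of L] by (simp add: assoc_mult_mat[of _ n n _ n _ n])
  also have "\<dots> = R ^\<^sub>m L" unfolding UU by (rule left_mult_one_mat[OF RL])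
  also have "(\<Sum>j<n. (R ^\<^sub>m L) $$ (j, j))
      = (\<Sum>j<n. \<Sum>w | w \<in> walks n L \<and> w 0 = j \<and> w L = j. \<Prod>t<L. R $$ (w t, w (Suc t)))"
    using pow_mat_walks[OF R] by simp
  also have "\<dots> = (\<Sum>w\<in>(\<Union>j<n. {w. w \<in> walks n L \<and> w 0 = j \<and> w L = j}). \<Prod>t<L. R $$ (w t, w (Suc t)))"
    by (subst sum.UNION_disjoint) auto
  also have "(\<Union>j<n. {w. w \<in> walks n L \<and> w 0 = j \<and> w L = j}) = {w. w \<in> walks n L \<and> w 0 = w L}"
    by (auto simp: walks_def)
  finally show ?thesis .
qed

text \<open>With an even exponent all terms of the power sum are nonnegative, so each eigenvalue
  separately is at most \<open>\<rho>\<close> in absolute value; the quadratic form is then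
  estimated in the eigenbasis. This turns a trace estimate into an operator norm estimate.\<close>

lemma symmetric_quadratic_bound:
  fixes R :: "real mat"
  assumes R: "R \<in> carrier_mat n n" "transpose_mat R = R"
    and \<rho>: "\<rho> \<ge> 0" "(\<Sum>w | w \<in> walks n (2 * m) \<and> w 0 = w (2 * m). \<Prod>t<2 * m. R $$ (w t, w (Suc t))) \<le> \<rho> ^ (2 * m)"
    and m: "m > 0" and x: "x \<in> carrier_vec n"
  shows "\<bar>x \<bullet> (R *\<^sub>v x)\<bar> \<le> \<rho> * (x \<bullet> x)"
proof -
  obtain es where "char_poly R = (\<Prod>e\<leftarrow>es. [:- e, 1:])"
    using symmetric_char_poly_splits[OF R] by blast
  then obtain U where U: "U \<in> carrier_mat n n" "transpose_mat U * U = 1\<^sub>m n"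
      "transpose_mat U * R * U = mat_diag n (\<lambda>i. es ! i)"
    using symmetric_diagonalization[OF R] by blast
  have es: "\<bar>es ! j\<bar> \<le> \<rho>" if "j < n" for j
  proof -
    have "\<bar>es ! j\<bar> ^ (2 * m) = (es ! j) ^ (2 * m)" by (simp add: power_even_abs)
    also have "\<dots> \<le> (\<Sum>j<n. (es ! j) ^ (2 * m))"
      using that by (intro member_le_sum) (auto simp: zero_le_even_power)
    also have "\<dots> \<le> \<rho> ^ (2 * m)" using \<rho>(2) sum_eigenvalue_powers[OF R(1) U] by simp
    finally show ?thesis using \<rho>(1) m by (subst (asm) power_mono_iff) auto
  qed
  have Ut: "transpose_mat U \<in> carrier_mat n n" using U by simp
  have UU: "U * transpose_mat U = 1\<^sub>m n" by (rule mat_mult_left_right_inverse[OF Ut U(1,2)])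
  define c where "c = transpose_mat U *\<^sub>v x"
  have c: "c \<in> carrier_vec n" unfolding c_def using Ut x by simp
  have xc: "x = U *\<^sub>v c"
    unfolding c_def using assoc_mult_mat_vec[OF U(1) Ut x] UU x by simp
  have "\<bar>x \<bullet> (R *\<^sub>v x)\<bar> = \<bar>\<Sum>i<n. es ! i * (c $ i)\<^sup>2\<bar>"
    unfolding xc quadratic_form_diagonalized[OF R(1) U(1,3) c] by simp
  also have "\<dots> \<le> (\<Sum>i<n. \<bar>es ! i\<bar> * (c $ i)\<^sup>2)"
    by (rule order_trans[OF sum_abs]) (simp add: abs_mult)
  also have "\<dots> \<le> (\<Sum>i<n. \<rho> * (c $ i)\<^sup>2)"
    using es by (intro sum_mono mult_right_mono) auto
  also have "\<dots> = \<rho> * (c \<bullet> c)" unfolding scalar_prod_self[OF c] by (simp add: sum_distrib_left)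
  also have "c \<bullet> c = x \<bullet> x" unfolding xc using orthogonal_scalar_prod[OF U(1,2) c c] by simp
  finally show ?thesis .
qed

text \<open>Individual walk products may be negative, but their sum is a sum of even powers of
  eigenvalues. The sign lets expectation bounds yield almost sure bounds.\<close>

lemma closed_walk_sum_nonneg:
  fixes R :: "real mat"
  assumes R: "R \<in> carrier_mat n n" "transpose_mat R = R"
  shows "(\<Sum>w | w \<in> walks n (2 * m) \<and> w 0 = w (2 * m). \<Prod>t<2 * m. R $$ (w t, w (Suc t))) \<ge> 0"
proof -
  obtain es where "char_poly R = (\<Prod>e\<leftarrow>es. [:- e, 1:])"
    using symmetric_char_poly_splits[OF R] by blast
  then obtain U where U: "U \<in> carrier_mat n n" "transpose_mat U * U = 1\<^sub>m n"
      "transpose_mat U * R * U = mat_diag n (\<lambda>i. es ! i)"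
    using symmetric_diagonalization[OF R] by blast
  show ?thesis
    unfolding sum_eigenvalue_powers[OF R(1) U, symmetric] by (intro sum_nonneg) (simp add: zero_le_even_power)
qed

section \<open>Counting walks by their edges and vertices\<close>

text \<open>Sorting the endpoints makes both directions of travel the same edge, and matches the
  index pairs \<open>i < j\<close> of the independent entries.\<close>

definition walk_edge :: "(nat \<Rightarrow> nat) \<Rightarrow> nat \<Rightarrow> nat \<times> nat" where
  "walk_edge w t = (min (w t) (w (Suc t)), max (w t) (w (Suc t)))"

text \<open>A vertex seen for the first time is reached by a new edge, since both ends of an old
  edge have already been visited.\<close>

lemma card_walk_vertices_le: "card (w ` {..L}) \<le> card (walk_edge w ` {..<L}) + 1"
proof (induction L)
  case (Suc L)
  have V: "w ` {..Suc L} = insert (w (Suc L)) (w ` {..L})" by (simp add: atMost_Suc)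
  have E: "walk_edge w ` {..<Suc L} = insert (walk_edge w L) (walk_edge w ` {..<L})"
    by (simp add: lessThan_Suc)
  show ?case
  proof (cases "w (Suc L) \<in> w ` {..L}")
    case True
    have "card (walk_edge w ` {..<L}) \<le> card (walk_edge w ` {..<Suc L})"
      by (intro card_mono) auto
    then show ?thesis using True Suc V by (simp add: insert_absorb)
  next
    case False
    have "walk_edge w L \<notin> walk_edge w ` {..<L}"
    proof
      assume "walk_edge w L \<in> walk_edge w ` {..<L}"
      then obtain t where t: "t < L" "walk_edge w L = walk_edge w t" by auto
      then have "w (Suc L) = w t \<or> w (Suc L) = w (Suc t)"
        by (auto simp: walk_edge_def min_def max_def split: if_splits)
      then show False using False t by (metis Suc_leI atMost_iff image_eqI less_imp_le_nat)
    qed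
    then show ?thesis using False Suc V E by simp
  qed
qed simp

lemma double_card_image_le:
  fixes g :: "nat \<Rightarrow> 'a"
  assumes "\<And>t. t < L \<Longrightarrow> \<exists>s<L. s \<noteq> t \<and> g s = g t"
  shows "2 * card (g ` {..<L}) \<le> L"
proof -
  have "2 * card (g ` {..<L}) = (\<Sum>e\<in>g ` {..<L}. 2)" by simp
  also have "\<dots> \<le> (\<Sum>e\<in>g ` {..<L}. card {t \<in> {..<L}. g t = e})"
  proof (rule sum_mono)
    fix e assume "e \<in> g ` {..<L}"
    then obtain t where t: "t < L" "g t = e" by auto
    obtain s where s: "s < L" "s \<noteq> t" "g s = g t" using assms[OF t(1)] by blast
    have "card {s, t} \<le> card {t \<in> {..<L}. g t = e}"
      using s t by (intro card_mono) auto
    then show "2 \<le> card {t \<in> {..<L}. g t = e}" using s by simp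
  qed
  also have "\<dots> = L"
    using sum.image_gen[of "{..<L}" "\<lambda>_. 1::nat" g] by simp
  finally show ?thesis .
qed

text \<open>Such a walk is determined by a table of \<open>Suc m\<close> vertices and, for each of
  the \<open>Suc L\<close> times, a label pointing into that table.\<close>

lemma card_walks_few_vertices:
  "card {w \<in> walks N L. card (w ` {..L}) \<le> Suc m} \<le> N ^ Suc m * Suc m ^ Suc L"
proof -
  let ?T = "({..m} \<rightarrow>\<^sub>E {..<N}) \<times> ({..L} \<rightarrow>\<^sub>E {..m})"
  let ?h = "\<lambda>(t, c). \<lambda>i\<in>{..L}. t (c i :: nat)"
  have fin: "finite ?T" by (intro finite_cartesian_product finite_PiE) auto
  have "{w \<in> walks N L. card (w ` {..L}) \<le> Suc m} \<subseteq> ?h ` ?T"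
  proof
    fix w assume "w \<in> {w \<in> walks N L. card (w ` {..L}) \<le> Suc m}"
    then have w: "w \<in> {..L} \<rightarrow>\<^sub>E {..<N}" and c: "card (w ` {..L}) \<le> card {..m}"
      by (auto simp: walks_def)
    let ?S = "w ` {..L}"
    obtain g where g: "g ` ?S \<subseteq> {..m}" "inj_on g ?S"
      using card_le_inj[OF _ _ c] by auto
    \<comment> \<open>Labels that no vertex uses receive \<open>w 0\<close>, merely to keep the
      table inside \<open>{..<N}\<close>.\<close>
    define t where "t = (\<lambda>j\<in>{..m}. if j \<in> g ` ?S then inv_into ?S g j else w 0)"
    define c where "c = (\<lambda>i\<in>{..L}. g (w i))"
    have "t \<in> {..m} \<rightarrow>\<^sub>E {..<N}"
    proof (rule PiE_I)
      fix j assume "j \<in> {..m}"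
      moreover have "inv_into ?S g j \<in> ?S" if "j \<in> g ` ?S" using that by (rule inv_into_into)
      moreover have "?S \<subseteq> {..<N}" "w 0 \<in> ?S" using w by (auto simp: PiE_iff)
      ultimately show "t j \<in> {..<N}" unfolding t_def by (simp del: image_iff) blast
    qed (simp add: t_def)
    moreover have "c \<in> {..L} \<rightarrow>\<^sub>E {..m}" using g(1) by (auto simp: c_def)
    moreover have "w = ?h (t, c)"
    proof
      fix i
      show "w i = ?h (t, c) i"
      proof (cases "i \<le> L")
        case True
        then have "g (w i) \<in> {..m}" using g(1) by auto
        then show ?thesis using True g(2) by (simp add: t_def c_def)
      qed (use w in auto)
    qed
    ultimately show "w \<in> ?h ` ?T" by blast
  qed
  then have "card {w \<in> walks N L. card (w ` {..L}) \<le> Suc m} \<le> card ?T"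
    using fin by (meson card_image_le card_mono finite_imageI order_trans)
  also have "\<dots> = N ^ Suc m * Suc m ^ Suc L"
    by (simp add: card_cartesian_product card_PiE)
  finally show ?thesis .
qed

text \<open>The product is at most the \<open>L\<close>-th power of its largest factor, which is one
  of the summands. This crude substitute for Hoelder's inequality suffices because constants
  depending on \<open>L\<close> are harmless.\<close>

lemma prod_le_sum_powers:
  fixes a :: "nat \<Rightarrow> real"
  assumes "\<And>t. t < L \<Longrightarrow> a t \<ge> 0" "L > 0"
  shows "(\<Prod>t<L. a t) \<le> (\<Sum>t<L. a t ^ L)"
proof -
  have "Max (a ` {..<L}) \<in> a ` {..<L}" using assms by (intro Max_in) auto
  then obtain s where s: "s < L" "a s = Max (a ` {..<L})" by auto
  have "(\<Prod>t<L. a t) \<le> (\<Prod>t<L. a s)"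
    using assms s by (intro prod_mono) auto
  also have "\<dots> = a s ^ L" by simp
  also have "\<dots> \<le> (\<Sum>t<L. a t ^ L)" using assms s by (intro member_le_sum) auto
  finally show ?thesis .
qed

section \<open>Expected traces of random symmetric matrices\<close>

context prob_space begin

text \<open>The sum of the \<open>L\<close>-th absolute powers dominates the product. The factors
  may be dependent, as happens when a walk repeats an edge.\<close>

lemma integrable_walk_product:
  fixes Y :: "nat \<Rightarrow> 'a \<Rightarrow> real"
  assumes rv: "\<And>t. t < L \<Longrightarrow> Y t \<in> borel_measurable M"
    and mom: "\<And>t. t < L \<Longrightarrow> integrable M (\<lambda>\<omega>. \<bar>Y t \<omega>\<bar> ^ L)"
    and K: "\<And>t. t < L \<Longrightarrow> expectation (\<lambda>\<omega>. \<bar>Y t \<omega>\<bar> ^ L) \<le> K" and L: "L > 0"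
  shows "integrable M (\<lambda>\<omega>. \<Prod>t<L. Y t \<omega>)" "expectation (\<lambda>\<omega>. \<Prod>t<L. Y t \<omega>) \<le> real L * K"
proof -
  have bound: "norm (\<Prod>t<L. Y t \<omega>) \<le> (\<Sum>t<L. \<bar>Y t \<omega>\<bar> ^ L)" for \<omega>
    using prod_le_sum_powers[of L "\<lambda>t. \<bar>Y t \<omega>\<bar>"] L by (simp add: abs_prod)
  have int: "integrable M (\<lambda>\<omega>. \<Sum>t<L. \<bar>Y t \<omega>\<bar> ^ L)"
    using mom by (intro Bochner_Integration.integrable_sum) auto
  show prod: "integrable M (\<lambda>\<omega>. \<Prod>t<L. Y t \<omega>)"
  proof (rule Bochner_Integration.integrable_bound[OF int])
    show "(\<lambda>\<omega>. \<Prod>t<L. Y t \<omega>) \<in> borel_measurable M"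
      using rv by (intro borel_measurable_prod) auto
    show "AE \<omega> in M. norm (\<Prod>t<L. Y t \<omega>) \<le> norm (\<Sum>t<L. \<bar>Y t \<omega>\<bar> ^ L)"
      using bound by (intro AE_I2) (metis abs_ge_self order_trans real_norm_def)
  qed
  have "expectation (\<lambda>\<omega>. \<Prod>t<L. Y t \<omega>) \<le> expectation (\<lambda>\<omega>. \<Sum>t<L. \<bar>Y t \<omega>\<bar> ^ L)"
  proof (rule integral_mono[OF prod int])
    fix \<omega> show "(\<Prod>t<L. Y t \<omega>) \<le> (\<Sum>t<L. \<bar>Y t \<omega>\<bar> ^ L)"
      using bound[of \<omega>] by (simp add: abs_le_iff)
  qed
  also have "\<dots> = (\<Sum>t<L. expectation (\<lambda>\<omega>. \<bar>Y t \<omega>\<bar> ^ L))"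
    using mom by (intro Bochner_Integration.integral_sum) auto
  also have "\<dots> \<le> (\<Sum>t<L. K)" using K by (intro sum_mono) auto
  finally show "expectation (\<lambda>\<omega>. \<Prod>t<L. Y t \<omega>) \<le> real L * K" by simp
qed

text \<open>Grouping equal indices turns the product into powers of distinct independent variables,
  so the expectation factors; the index used once appears with exponent 1 and contributes its mean,
  which is zero.\<close>

lemma expectation_walk_product_eq_0:
  fixes X :: "'i \<Rightarrow> 'a \<Rightarrow> real" and g :: "nat \<Rightarrow> 'i"
  assumes indep: "indep_vars (\<lambda>_. borel) X I"
    and mom: "\<And>e n. e \<in> I \<Longrightarrow> integrable M (\<lambda>\<omega>. \<bar>X e \<omega>\<bar> ^ n)"
    and mean: "\<And>e. e \<in> I \<Longrightarrow> expectation (X e) = 0"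
    and g: "\<And>t. t < L \<Longrightarrow> g t \<in> I"
    and once: "s < L" "\<And>t. t < L \<Longrightarrow> t \<noteq> s \<Longrightarrow> g t \<noteq> g s"
  shows "expectation (\<lambda>\<omega>. \<Prod>t<L. X (g t) \<omega>) = 0"
proof -
  let ?E = "g ` {..<L}"
  let ?mult = "\<lambda>e. card {t \<in> {..<L}. g t = e}"
  have E: "?E \<subseteq> I" using g by auto
  have rv: "X e \<in> borel_measurable M" if "e \<in> I" for e
    using indep that by (auto simp: indep_vars_def)
  have "(\<Prod>t<L. X (g t) \<omega>) = (\<Prod>e\<in>?E. X e \<omega> ^ ?mult e)" for \<omega>
  proof -
    have "(\<Prod>t<L. X (g t) \<omega>) = (\<Prod>e\<in>?E. \<Prod>t\<in>{t \<in> {..<L}. g t = e}. X (g t) \<omega>)"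
      by (rule prod.image_gen) simp
    also have "\<dots> = (\<Prod>e\<in>?E. X e \<omega> ^ ?mult e)" by (intro prod.cong) simp_all
    finally show ?thesis .
  qed
  then have "expectation (\<lambda>\<omega>. \<Prod>t<L. X (g t) \<omega>) = expectation (\<lambda>\<omega>. \<Prod>e\<in>?E. X e \<omega> ^ ?mult e)"
    by simp
  also have "\<dots> = (\<Prod>e\<in>?E. expectation (\<lambda>\<omega>. X e \<omega> ^ ?mult e))"
  proof (rule indep_vars_lebesgue_integral)
    show "indep_vars (\<lambda>_. borel) (\<lambda>e \<omega>. X e \<omega> ^ ?mult e) ?E"
      by (rule indep_vars_compose2[OF indep_vars_subset[OF indep E]]) simp
    fix e assume "e \<in> ?E"
    then have e: "e \<in> I" using E by auto
    show "integrable M (\<lambda>\<omega>. X e \<omega> ^ ?mult e)"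
      by (rule Bochner_Integration.integrable_bound[OF mom[OF e, of "?mult e"]])
        (use rv[OF e] in \<open>auto simp: power_abs\<close>)
  qed simp
  also have "\<dots> = 0"
  proof (rule prod_zero)
    have "{t \<in> {..<L}. g t = g s} = {s}" using once by blast
    then have "expectation (\<lambda>\<omega>. X (g s) \<omega> ^ ?mult (g s)) = 0" using mean g once by simp
    then show "\<exists>e\<in>?E. expectation (\<lambda>\<omega>. X e \<omega> ^ ?mult e) = 0" using once by blast
  qed simp
  finally show ?thesis .
qed

text \<open>Only walks with at most \<open>Suc m\<close> vertices can have nonzero expectation.
  Their number supplies the power of \<open>N\<close>, and the moment bound controls each of them
  uniformly.\<close>

lemma expected_closed_walk_sum:
  fixes X :: "nat \<times> nat \<Rightarrow> 'a \<Rightarrow> real" and f :: "nat \<Rightarrow> 'c"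
  defines "r \<equiv> \<lambda>\<omega> i j. if f i = f j then 0 else X (min i j, max i j) \<omega>"
  assumes indep: "indep_vars (\<lambda>_. borel) X {(i, j). i < j \<and> j < N}"
    and mom: "\<And>i j n. i < j \<Longrightarrow> j < N \<Longrightarrow> integrable M (\<lambda>\<omega>. \<bar>X (i, j) \<omega>\<bar> ^ n)"
    and mean: "\<And>i j. i < j \<Longrightarrow> j < N \<Longrightarrow> expectation (X (i, j)) = 0"
    and K: "\<And>i j. i < j \<Longrightarrow> j < N \<Longrightarrow> expectation (\<lambda>\<omega>. \<bar>X (i, j) \<omega>\<bar> ^ (2 * m)) \<le> K"
    and K0: "K \<ge> 0" and m: "m > 0"
  shows "integrable M (\<lambda>\<omega>. \<Sum>w | w \<in> walks N (2 * m) \<and> w 0 = w (2 * m). \<Prod>t<2 * m. r \<omega> (w t) (w (Suc t)))"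
      (is "integrable M (\<lambda>\<omega>. \<Sum>w\<in>?C. ?p w \<omega>)")
    and "expectation (\<lambda>\<omega>. \<Sum>w | w \<in> walks N (2 * m) \<and> w 0 = w (2 * m). \<Prod>t<2 * m. r \<omega> (w t) (w (Suc t)))
      \<le> 2 * real m * K * real (Suc m) ^ Suc (2 * m) * real N ^ Suc m"
proof -
  let ?I = "{(i, j). i < j \<and> j < N}"
  let ?G = "{w \<in> walks N (2 * m). card (w ` {..2 * m}) \<le> Suc m}"
  have rv: "X e \<in> borel_measurable M" if "e \<in> ?I" for e
    using indep that by (auto simp: indep_vars_def)
  have momI: "integrable M (\<lambda>\<omega>. \<bar>X e \<omega>\<bar> ^ n)" if "e \<in> ?I" for e n using mom that by auto
  have "integrable M (?p w) \<and> expectation (?p w) \<le> (if w \<in> ?G then 2 * real m * K else 0)"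
    if w: "w \<in> walks N (2 * m)" for w
  \<comment> \<open>A step inside a colour class gives a zero factor. Otherwise consecutive vertices
    differ, so each edge indexes one of the independent variables.\<close>
  proof (cases "\<exists>t<2 * m. f (w t) = f (w (Suc t))")
    case True
    then have "?p w = (\<lambda>_. 0)" by (auto simp: r_def fun_eq_iff intro!: prod_zero)
    then show ?thesis using K0 by simp
  next
    case False
    then have p: "?p w = (\<lambda>\<omega>. \<Prod>t<2 * m. X (walk_edge w t) \<omega>)"
      by (auto simp: r_def walk_edge_def fun_eq_iff intro!: prod.cong)
    have eI: "walk_edge w t \<in> ?I" if "t < 2 * m" for t
    proof -
      have "w t \<noteq> w (Suc t)" using False that by metis
      moreover have "w t < N" "w (Suc t) < N" using w that by (auto simp: walks_def PiE_iff)
      ultimately show ?thesis by (auto simp: walk_edge_def min_def max_def)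
    qed
    have KI: "expectation (\<lambda>\<omega>. \<bar>X e \<omega>\<bar> ^ (2 * m)) \<le> K" if "e \<in> ?I" for e using K that by auto
    have "0 < 2 * m" using m by simp
    note product = integrable_walk_product[of "2 * m" "\<lambda>t. X (walk_edge w t)" K,
        OF rv[OF eI] momI[OF eI] KI[OF eI] this]
    have int: "integrable M (?p w)" and le: "expectation (?p w) \<le> real (2 * m) * K"
      unfolding p by (rule product; assumption)+
    show ?thesis
    proof (cases "w \<in> ?G")
      case True
      then show ?thesis using int le by simp
    next
      case False
      \<comment> \<open>More than \<open>Suc m\<close> vertices force more than \<open>m\<close>
        distinct edges, too many for \<open>2 * m\<close> steps to traverse each one twice.\<close>
      then have "\<not> 2 * card (walk_edge w ` {..<2 * m}) \<le> 2 * m"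
        using w card_walk_vertices_le[of w "2 * m"] by auto
      then obtain s where s: "s < 2 * m" "\<And>t. t < 2 * m \<Longrightarrow> t \<noteq> s \<Longrightarrow> walk_edge w t \<noteq> walk_edge w s"
        using double_card_image_le[of "2 * m" "walk_edge w"] by blast
      have "expectation (?p w) = 0"
        unfolding p using momI mean eI s
        by (intro expectation_walk_product_eq_0[where I = ?I and s = s] indep) auto
      then show ?thesis using int False K0 by simp
    qed
  qed
  then have int: "integrable M (?p w)"
    and le: "expectation (?p w) \<le> (if w \<in> ?G then 2 * real m * K else 0)" if "w \<in> ?C" for w
    using that by auto
  show "integrable M (\<lambda>\<omega>. \<Sum>w\<in>?C. ?p w \<omega>)" using int by (rule Bochner_Integration.integrable_sum)
  have "expectation (\<lambda>\<omega>. \<Sum>w\<in>?C. ?p w \<omega>) = (\<Sum>w\<in>?C. expectation (?p w))"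
    using int by (rule Bochner_Integration.integral_sum)
  also have "\<dots> \<le> (\<Sum>w\<in>?C. if w \<in> ?G then 2 * real m * K else 0)" using le by (rule sum_mono)
  also have "\<dots> \<le> (\<Sum>w\<in>walks N (2 * m). if w \<in> ?G then 2 * real m * K else 0)"
    using K0 by (intro sum_mono2) auto
  also have "\<dots> = (\<Sum>w\<in>?G. 2 * real m * K)"
    by (intro sum.mono_neutral_cong_right) auto
  also have "\<dots> = real (card ?G) * (2 * real m * K)" by simp
  also have "\<dots> \<le> real (N ^ Suc m * Suc m ^ Suc (2 * m)) * (2 * real m * K)"
    using card_walks_few_vertices[of N "2 * m" m] K0 by (intro mult_right_mono) (simp_all only: of_nat_le_iff, simp)
  also have "\<dots> = 2 * real m * K * real (Suc m) ^ Suc (2 * m) * real N ^ Suc m"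
    by (simp only: of_nat_mult of_nat_power mult_ac)
  finally show "expectation (\<lambda>\<omega>. \<Sum>w\<in>?C. ?p w \<omega>) \<le> 2 * real m * K * real (Suc m) ^ Suc (2 * m) * real N ^ Suc m" .
qed

end

section \<open>Reindexing independent families and almost sure boundedness\<close>

context prob_space begin

text \<open>Serves to fix the matrix size \<open>N\<close> and shift to 0-based indices inside the
  family indexed by triples. Injectivity ensures that distinct new indices still refer to distinct
  members.\<close>

lemma indep_vars_reindex_inj:
  assumes X: "indep_vars M' X I" and h: "inj_on h J" "h ` J \<subseteq> I"
  shows "indep_vars (\<lambda>j. M' (h j)) (\<lambda>j. X (h j)) J"
  unfolding indep_vars_def2
proof (intro conjI ballI indep_setsI)
  let ?F = "\<lambda>i. {X i -` A \<inter> space M | A. A \<in> sets (M' i)}"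
  have F: "indep_sets ?F I" and rv: "\<And>i. i \<in> I \<Longrightarrow> random_variable (M' i) (X i)"
    using X unfolding indep_vars_def2 by auto
  show "random_variable (M' (h j)) (X (h j))" if "j \<in> J" for j using rv h that by auto
  show "?F (h j) \<subseteq> events" if "j \<in> J" for j
    using rv[of "h j"] h that by (auto intro: measurable_sets)
  fix A K assume K: "K \<noteq> {}" "K \<subseteq> J" "finite K" and A: "\<forall>j\<in>K. A j \<in> ?F (h j)"
  have inj: "inj_on h K" using h(1) K(2) by (rule inj_on_subset)
  let ?A = "\<lambda>i. A (inv_into K h i)"
  have "prob (\<Inter>i\<in>h ` K. ?A i) = (\<Prod>i\<in>h ` K. prob (?A i))"
  proof (rule indep_setsD[OF F])
    show "h ` K \<subseteq> I" using K(2) h(2) by blast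
  qed (use K A inj in auto)
  then show "prob (\<Inter>j\<in>K. A j) = (\<Prod>j\<in>K. prob (A j))"
    using inj by (simp add: prod.reindex)
qed

text \<open>By monotone convergence the sum of all \<open>Z N\<close> has finite expectation, so it
  is almost surely finite, and it bounds every term. This takes the place of Markov's inequality
  with Borel-Cantelli.\<close>

lemma AE_bounded_if_summable_expectation:
  fixes Z :: "nat \<Rightarrow> 'a \<Rightarrow> real"
  assumes int: "\<And>N. integrable M (Z N)" and nonneg: "\<And>N \<omega>. Z N \<omega> \<ge> 0"
    and sum: "summable (\<lambda>N. expectation (Z N))"
  shows "AE \<omega> in M. \<exists>K. \<forall>N. Z N \<omega> \<le> K"
proof -
  let ?S = "\<lambda>\<omega>. \<Sum>N. ennreal (Z N \<omega>)"
  have [measurable]: "Z N \<in> borel_measurable M" for N using int by auto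
  have E0: "expectation (Z N) \<ge> 0" for N using nonneg by (intro integral_nonneg_AE) auto
  have "(\<integral>\<^sup>+\<omega>. ?S \<omega> \<partial>M) = (\<Sum>N. \<integral>\<^sup>+\<omega>. ennreal (Z N \<omega>) \<partial>M)"
    by (rule nn_integral_suminf) simp
  also have "\<dots> = (\<Sum>N. ennreal (expectation (Z N)))"
    using int nonneg by (simp add: nn_integral_eq_integral)
  also have "\<dots> = ennreal (\<Sum>N. expectation (Z N))"
    by (rule suminf_ennreal2[OF E0 sum])
  finally have "(\<integral>\<^sup>+\<omega>. ?S \<omega> \<partial>M) \<noteq> \<infinity>" by simp
  then have "AE \<omega> in M. ?S \<omega> \<noteq> \<infinity>" by (intro nn_integral_noteq_infinite) simp_all
  then show ?thesis
  proof (rule AE_mp, intro AE_I2 impI exI allI)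
    fix \<omega> N assume fin: "?S \<omega> \<noteq> \<infinity>"
    have "ennreal (Z N \<omega>) \<le> ?S \<omega>"
      using sum_le_suminf[of "\<lambda>N. ennreal (Z N \<omega>)" "{N}"] by simp
    then have "enn2real (ennreal (Z N \<omega>)) \<le> enn2real (?S \<omega>)"
      using fin by (intro enn2real_mono) (auto simp: less_top)
    then show "Z N \<omega> \<le> enn2real (?S \<omega>)" using nonneg by simp
  qed
qed

end

section \<open>Checkerboard matrices\<close>

lemma card_nth_eq_length_filter:
  "card {i. i < length xs \<and> P (xs ! i)} = length (filter P xs)"
  by (simp add: length_filter_conv_card)

definition offpattern_matrix :: "nat \<Rightarrow> (nat \<Rightarrow> nat \<Rightarrow> real) \<Rightarrow> nat \<Rightarrow> real mat" where
  "offpattern_matrix k a N = mat N N (\<lambda>(i, j). if Suc i mod k = Suc j mod k then 0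
     else a (Suc (min i j)) (Suc (max i j)))"

lemma offpattern_matrix_carrier [simp]: "offpattern_matrix k a N \<in> carrier_mat N N"
  by (simp add: offpattern_matrix_def)

lemma offpattern_matrix_symmetric: "transpose_mat (offpattern_matrix k a N) = offpattern_matrix k a N"
  by (intro eq_matI) (auto simp: offpattern_matrix_def min.commute max.commute)

text \<open>Translates the index set \<open>{1..k}\<close> of \<open>W\<close> to residues below
  \<open>k\<close>: residue 0 stands for the class of \<open>k\<close>.\<close>

definition residue_weight :: "nat \<Rightarrow> (nat \<Rightarrow> real) \<Rightarrow> nat \<Rightarrow> real" where
  "residue_weight k W r = W (if r = 0 then k else r)"

lemma card_residue_weight:
  assumes "k \<ge> 1"
  shows "card {r. r < k \<and> P (residue_weight k W r)} = card {u \<in> {1..k}. P (W u)}"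
proof (rule bij_betw_same_card)
  show "bij_betw (\<lambda>r. if r = 0 then k else r) {r. r < k \<and> P (residue_weight k W r)} {u \<in> {1..k}. P (W u)}"
    using assms by (intro bij_betw_byWitness[where f' = "\<lambda>u. if u = k then 0 else u"])
      (auto simp: residue_weight_def)
qed

text \<open>The deterministic half of the argument. Sorted eigenvalues of the matrix and of its
  constant part \<open>S\<close> are matched by position, and each inherits the weight behind its
  partner. The error is \<open>\<rho>\<close> from Weyl's inequality, plus a weight times the
  deviation, at most 2, of a class size from \<open>N / k\<close>.\<close>

lemma checkerboard_spectrum:
  fixes W :: "nat \<Rightarrow> real"
  assumes k: "k \<ge> 1" and N: "k \<le> N"
    and \<rho>: "\<And>x. x \<in> carrier_vec N \<Longrightarrow> \<bar>x \<bullet> (offpattern_matrix k a N *\<^sub>v x)\<bar> \<le> \<rho> * (x \<bullet> x)"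
  shows "\<exists>(lam :: nat \<Rightarrow> real) (g :: nat \<Rightarrow> real).
             char_poly (checkerboard_matrix k W a N) = (\<Prod>i<N. [:- lam i, 1:])
           \<and> (\<forall>i<N. g i \<in> insert 0 (W ` {1..k}))
           \<and> card {i. i < N \<and> g i = 0} = N - card {u \<in> {1..k}. W u \<noteq> 0}
           \<and> (\<forall>v \<in> W ` {1..k}. v \<noteq> 0 \<longrightarrow>
                 card {i. i < N \<and> g i = v} = card {u \<in> {1..k}. W u = v})
           \<and> (\<forall>i<N. \<bar>lam i - real N * g i / real k\<bar> \<le> \<rho> + 2 * (\<Sum>u=1..k. \<bar>W u\<bar>))"
proof -
  let ?A = "checkerboard_matrix k W a N" and ?R = "offpattern_matrix k a N"
  let ?w = "residue_weight k W"
  define f where "f i = Suc i mod k" for i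
  define S where "S = mat N N (\<lambda>(i, j). if f i = f j then ?w (f i) else 0)"
  have A: "?A \<in> carrier_mat N N" by (simp add: checkerboard_matrix_def)
  have S: "S \<in> carrier_mat N N" by (simp add: S_def)
  have ASR: "?A = S + ?R"
    by (intro eq_matI)
      (auto simp: checkerboard_matrix_def S_def offpattern_matrix_def cb_entry_def f_def residue_weight_def
        min_def max_def)
  have symS: "transpose_mat S = S" by (intro eq_matI) (auto simp: S_def)
  have symA: "transpose_mat ?A = ?A"
    unfolding ASR using S by (simp add: transpose_add[of _ N N] symS offpattern_matrix_symmetric)
  obtain es where es: "char_poly ?A = (\<Prod>e\<leftarrow>es. [:- e, 1:])"
    using symmetric_char_poly_splits[OF A symA] by blast
  define as where "as = sort es"
  have prod_mset_eq: "(\<Prod>e\<leftarrow>xs. [:- e, 1:]) = (\<Prod>e\<leftarrow>ys. [:- e, 1:])" if "mset xs = mset ys" for xs ys :: "real list"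
    using that by (metis mset_map prod_mset_prod_list)
  have as: "char_poly ?A = (\<Prod>e\<leftarrow>as. [:- e, 1:])"
    unfolding es as_def by (rule prod_mset_eq) simp
  have "degree (\<Prod>e\<leftarrow>xs. [:- e, 1:]) = length xs" for xs :: "real list"
    using degree_linear_factors[of uminus xs] by (simp add: comp_def)
  then have len_as: "length as = N" using degree_monic_char_poly[OF A] as by simp
  define \<mu> where "\<mu> r = ?w r * of_nat (card {i. i < N \<and> f i = r})" for r
  \<comment> \<open>Each eigenvalue of \<open>S\<close> is paired with its weight, so that the label
    survives sorting by eigenvalue.\<close>
  define ps where "ps = replicate (N - k) (0, 0) @ map (\<lambda>r. (\<mu> r, ?w r)) [0..<k]"
  define qs where "qs = sort_key fst ps"
  have len_qs: "length qs = N" using N by (simp add: qs_def ps_def)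
  have "char_poly S = (\<Prod>e\<leftarrow>map fst ps. [:- e, 1:])"
    using char_poly_block_constant[of N f k ?w] N k
    by (simp add: S_def f_def ps_def \<mu>_def comp_def)
  also have "\<dots> = (\<Prod>e\<leftarrow>map fst qs. [:- e, 1:])"
    by (rule prod_mset_eq) (simp add: qs_def)
  finally have bs: "char_poly S = (\<Prod>e\<leftarrow>map fst qs. [:- e, 1:])" .
  obtain U where U: "U \<in> carrier_mat N N" "transpose_mat U * U = 1\<^sub>m N"
      "transpose_mat U * ?A * U = mat_diag N (\<lambda>i. as ! i)"
    using symmetric_diagonalization[OF A symA as] by blast
  obtain V where V: "V \<in> carrier_mat N N" "transpose_mat V * V = 1\<^sub>m N"
      "transpose_mat V * S * V = mat_diag N (\<lambda>i. map fst qs ! i)"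
    using symmetric_diagonalization[OF S symS bs] by blast
  have near: "\<bar>as ! i - map fst qs ! i\<bar> \<le> \<rho>" if "i < N" for i
  proof (rule weyl[OF A S U V _ _ _ that])
    show "as ! i \<le> as ! j" if "i \<le> j" "j < N" for i j
      using that len_as by (simp add: as_def sorted_nth_mono)
    show "map fst qs ! i \<le> map fst qs ! j" if "i \<le> j" "j < N" for i j
      using that len_qs by (intro sorted_nth_mono) (simp_all add: qs_def)
    show "\<bar>x \<bullet> (?A *\<^sub>v x) - x \<bullet> (S *\<^sub>v x)\<bar> \<le> \<rho> * (x \<bullet> x)" if x: "x \<in> carrier_vec N" for x
    proof -
      have "?A *\<^sub>v x = S *\<^sub>v x + ?R *\<^sub>v x"
        unfolding ASR using S x by (simp add: add_mult_distrib_mat_vec[of _ N N])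
      then have "x \<bullet> (?A *\<^sub>v x) = x \<bullet> (S *\<^sub>v x) + x \<bullet> (?R *\<^sub>v x)"
        using S x by (simp add: scalar_prod_add_distrib[of _ N] mult_mat_vec_carrier[of _ N N])
      then show ?thesis using \<rho>[OF x] by simp
    qed
  qed
  define g where "g i = snd (qs ! i)" for i
  have w_in: "?w r \<in> W ` {1..k}" if "r < k" for r
    using that k by (auto simp: residue_weight_def)
  have qs_cases: "(fst (qs ! i) = 0 \<and> g i = 0) \<or> (\<exists>r<k. fst (qs ! i) = \<mu> r \<and> g i = ?w r)" if "i < N" for i
  proof -
    have "qs ! i \<in> set ps" using nth_mem[of i qs] that len_qs by (simp add: qs_def)
    then show ?thesis unfolding ps_def g_def by (auto split: if_splits)
  qed
  \<comment> \<open>Sorting permutes the pairs, so labels can be counted in \<open>ps\<close>; the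
    label 0 gains the \<open>N - k\<close> padding pairs.\<close>
  have count: "card {i. i < N \<and> g i = v} = (if v = 0 then N - k else 0) + card {u \<in> {1..k}. W u = v}" for v
  proof -
    have "card {i. i < N \<and> g i = v} = length (filter (\<lambda>p. snd p = v) qs)"
      using card_nth_eq_length_filter[of qs "\<lambda>p. snd p = v"] len_qs by (simp add: g_def)
    also have "\<dots> = length (filter (\<lambda>p. snd p = v) ps)"
      by (metis qs_def mset_filter mset_sort size_mset)
    also have "\<dots> = (if v = 0 then N - k else 0) + card {r. r < k \<and> ?w r = v}"
    proof -
      have "length (filter (\<lambda>r. ?w r = v) [0..<k]) = card {r. r < k \<and> ?w r = v}"
        using card_nth_eq_length_filter[of "[0..<k]" "\<lambda>r. ?w r = v"]
        by (simp cong: conj_cong)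
      then show ?thesis by (simp add: ps_def filter_map comp_def)
    qed
    finally show ?thesis using card_residue_weight[OF k, of "\<lambda>z. z = v" W] by simp
  qed
  have "card ({u \<in> {1..k}. W u = 0} \<union> {u \<in> {1..k}. W u \<noteq> 0})
      = card {u \<in> {1..k}. W u = 0} + card {u \<in> {1..k}. W u \<noteq> 0}"
    by (rule card_Un_disjoint) auto
  moreover have "{u \<in> {1..k}. W u = 0} \<union> {u \<in> {1..k}. W u \<noteq> 0} = {1..k}" by auto
  ultimately have "card {i. i < N \<and> g i = 0} = N - card {u \<in> {1..k}. W u \<noteq> 0}"
    using count[of 0] N by simp
  moreover have "\<bar>as ! i - real N * g i / real k\<bar> \<le> \<rho> + 2 * (\<Sum>u=1..k. \<bar>W u\<bar>)" if i: "i < N" for i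
  proof -
    have "\<bar>fst (qs ! i) - real N * g i / real k\<bar> \<le> 2 * (\<Sum>u=1..k. \<bar>W u\<bar>)"
      using qs_cases[OF i]
    proof (elim disjE exE conjE)
      fix r assume r: "r < k" "fst (qs ! i) = \<mu> r" "g i = ?w r"
      have "\<bar>fst (qs ! i) - real N * g i / real k\<bar>
          = \<bar>?w r\<bar> * \<bar>real (card {i. i < N \<and> f i = r}) - real N / real k\<bar>"
        unfolding r(2,3) \<mu>_def abs_mult[symmetric] by (simp add: algebra_simps)
      also have "\<dots> \<le> \<bar>?w r\<bar> * 2"
        using card_residue_class[OF k r(1), of N] by (intro mult_left_mono) (simp_all add: f_def)
      also have "\<bar>?w r\<bar> \<le> (\<Sum>u=1..k. \<bar>W u\<bar>)"
      proof -
        obtain u where "u \<in> {1..k}" "?w r = W u" using w_in[OF r(1)] by auto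
        then show ?thesis by (simp only:) (rule member_le_sum, auto)
      qed
      finally show ?thesis by simp
    qed (simp add: sum_nonneg)
    then show ?thesis using near[OF i] i len_qs by simp
  qed
  moreover have "char_poly ?A = (\<Prod>i<N. [:- (as ! i), 1:])"
    unfolding as by (simp add: prod.list_conv_set_nth len_as atLeast0LessThan)
  moreover have "\<forall>i<N. g i \<in> insert 0 (W ` {1..k})" using qs_cases w_in by (metis insertCI)
  ultimately show ?thesis using count
    by (intro exI[of _ "\<lambda>i. as ! i"] exI[of _ g]) auto
qed

section \<open>Almost sure growth of the random part\<close>

text \<open>The constant may depend on the sample point but serves all \<open>N\<close> at once. The
  bound is phrased for quadratic forms, the shape in which Weyl's inequality takes its
  perturbation.\<close>

lemma offpattern_spectral_radius_growth:
  fixes M :: "'s measure" and a :: "nat \<Rightarrow> nat \<Rightarrow> nat \<Rightarrow> 's \<Rightarrow> real" and D :: "real measure"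
  assumes "prob_space M"
    and indep: "prob_space.indep_vars M (\<lambda>_. borel) (\<lambda>(N, i, j). a N i j)
                  {(N, i, j). 1 \<le> i \<and> i < j \<and> j \<le> N}"
    and ident: "\<And>N i j. 1 \<le> i \<Longrightarrow> i < j \<Longrightarrow> j \<le> N \<Longrightarrow> distr M borel (a N i j) = D"
    and moments: "\<And>N i j n. 1 \<le> i \<Longrightarrow> i < j \<Longrightarrow> j \<le> N \<Longrightarrow>
                    integrable M (\<lambda>\<omega>. \<bar>a N i j \<omega>\<bar> ^ n)"
    and mean: "\<And>N i j. 1 \<le> i \<Longrightarrow> i < j \<Longrightarrow> j \<le> N \<Longrightarrow> (\<integral>\<omega>. a N i j \<omega> \<partial>M) = 0"
    and \<epsilon>: "\<epsilon> > 0"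
  shows "AE \<omega> in M. \<exists>C \<ge> 0. \<forall>N \<ge> 1. \<forall>x \<in> carrier_vec N.
    \<bar>x \<bullet> (offpattern_matrix k (\<lambda>i j. a N i j \<omega>) N *\<^sub>v x)\<bar> \<le> C * real N powr (1/2 + \<epsilon>) * (x \<bullet> x)"
proof -
  interpret prob_space M by fact
  \<comment> \<open>The ceiling gives \<open>2 * real m * \<epsilon> \<ge> 3\<close>, so the
    exponent \<open>1 - 2 * real m * \<epsilon>\<close> met below is at most -2; \<open>Suc\<close>
    keeps \<open>m\<close> positive.\<close>
  define m where "m = Suc (nat \<lceil>3 / (2 * \<epsilon>)\<rceil>)"
  have m: "m > 0" by (simp add: m_def)
  have "3 / (2 * \<epsilon>) \<le> real m" unfolding m_def by linarith
  then have m_large: "2 * real m * \<epsilon> \<ge> 3" using \<epsilon> by (simp add: field_simps)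
  \<comment> \<open>The common law \<open>D\<close> makes one moment bound valid for all
    \<open>N\<close>, \<open>i\<close> and \<open>j\<close>.\<close>
  define K where "K = (\<integral>y. \<bar>y\<bar> ^ (2 * m) \<partial>D)"
  have K0: "K \<ge> 0" unfolding K_def by (simp add: integral_nonneg_AE)
  define X where "X N = (\<lambda>(i, j). a N (Suc i) (Suc j))" for N
  have indepX: "indep_vars (\<lambda>_. borel) (X N) {(i, j). i < j \<and> j < N}" for N
  proof -
    have "indep_vars (\<lambda>_. borel) (\<lambda>p. (\<lambda>(N, i, j). a N i j) ((\<lambda>(i, j). (N, Suc i, Suc j)) p)) {(i, j). i < j \<and> j < N}"
      by (rule indep_vars_reindex_inj[OF indep]) (auto simp: inj_on_def)
    then show ?thesis by (simp add: X_def case_prod_unfold)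
  qed
  let ?R = "\<lambda>N \<omega>. offpattern_matrix k (\<lambda>i j. a N i j \<omega>) N"
  define Y where "Y N \<omega> = (\<Sum>w | w \<in> walks N (2 * m) \<and> w 0 = w (2 * m). \<Prod>t<2 * m. ?R N \<omega> $$ (w t, w (Suc t)))" for N \<omega>
  define B where "B = 2 * real m * K * real (Suc m) ^ Suc (2 * m)"
  have B0: "B \<ge> 0" unfolding B_def using K0 by simp
  \<comment> \<open>This is the walk sum of \<open>expected_closed_walk_sum\<close> with the
    colouring of \<open>i\<close> by \<open>Suc i mod k\<close>.\<close>
  have Y_eq: "Y N \<omega> = (\<Sum>w | w \<in> walks N (2 * m) \<and> w 0 = w (2 * m). \<Prod>t<2 * m.
      if Suc (w t) mod k = Suc (w (Suc t)) mod k then 0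
      else X N (min (w t) (w (Suc t)), max (w t) (w (Suc t))) \<omega>)" for N \<omega>
    unfolding Y_def offpattern_matrix_def X_def
    by (intro sum.cong prod.cong refl) (auto simp: walks_def PiE_iff)
  have K: "expectation (\<lambda>\<omega>. \<bar>X N (i, j) \<omega>\<bar> ^ (2 * m)) \<le> K" if "i < j" "j < N" for N i j
  proof -
    have rv: "a N (Suc i) (Suc j) \<in> borel_measurable M"
      using indep that by (auto simp: indep_vars_def dest: bspec[of _ _ "(N, Suc i, Suc j)"])
    have "K = (\<integral>y. \<bar>y\<bar> ^ (2 * m) \<partial>distr M borel (a N (Suc i) (Suc j)))"
      unfolding K_def using ident[of "Suc i" "Suc j" N] that by simp
    also have "\<dots> = expectation (\<lambda>\<omega>. \<bar>X N (i, j) \<omega>\<bar> ^ (2 * m))"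
      using rv by (simp add: integral_distr X_def)
    finally show ?thesis by simp
  qed
  have intY: "integrable M (Y N)" and EY: "expectation (Y N) \<le> B * real N ^ Suc m" for N
  proof -
    have *: "integrable M (\<lambda>\<omega>. \<bar>X N (i, j) \<omega>\<bar> ^ n)" "expectation (X N (i, j)) = 0"
      if "i < j" "j < N" for i j n
      using moments[of "Suc i" "Suc j" N n] mean[of "Suc i" "Suc j" N] that by (simp_all add: X_def)
    note walk = expected_closed_walk_sum[where f = "\<lambda>i. Suc i mod k", OF indepX[of N] * K K0 m]
    show "integrable M (Y N)" unfolding Y_eq by (rule walk(1))
    show "expectation (Y N) \<le> B * real N ^ Suc m" unfolding Y_eq B_def by (rule walk(2))
  qed
  have Y0: "Y N \<omega> \<ge> 0" for N \<omega>
    unfolding Y_def by (intro closed_walk_sum_nonneg) (simp_all add: offpattern_matrix_symmetric)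
  define s where "s N = (real N powr (1/2 + \<epsilon>)) ^ (2 * m)" for N
  have s_eq: "s N = real N powr (real m + 2 * real m * \<epsilon>)" if "N > 0" for N
    using that by (simp add: s_def powr_power algebra_simps)
  have "AE \<omega> in M. \<exists>C. \<forall>N. Y N \<omega> / s N \<le> C"
  proof (rule AE_bounded_if_summable_expectation)
    show "integrable M (\<lambda>\<omega>. Y N \<omega> / s N)" for N using intY by simp
    show "Y N \<omega> / s N \<ge> 0" for N \<omega> using Y0 by (simp add: s_def)
    show "summable (\<lambda>N. expectation (\<lambda>\<omega>. Y N \<omega> / s N))"
    \<comment> \<open>The comparison begins at 1 because \<open>s 0\<close> is 0; there the quotient
      is 0 by the convention for division.\<close>
    proof (rule summable_comparison_test'[where N = 1])
      show "summable (\<lambda>N. B * (1 / real N ^ 2))"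
        using inverse_power_summable[of 2, where 'a = real]
        by (intro summable_mult) (simp add: inverse_eq_divide)
      fix N :: nat assume N: "N \<ge> 1"
      have "expectation (\<lambda>\<omega>. Y N \<omega> / s N) = expectation (Y N) / s N" by simp
      also have "\<dots> \<le> B * real N ^ Suc m / s N"
        using EY[of N] by (intro divide_right_mono) (simp_all add: s_def)
      also have "\<dots> = B * real N powr (1 - 2 * real m * \<epsilon>)"
      proof -
        have "real N ^ Suc m = real N powr (1 + real m)"
          using N by (simp add: powr_add powr_realpow)
        moreover have "real N powr (1 + real m) / s N = real N powr (1 - 2 * real m * \<epsilon>)"
          using N by (simp add: s_eq powr_diff[symmetric])
        ultimately show ?thesis by (metis times_divide_eq_right)
      qed
      also have "\<dots> \<le> B * real N powr (- 2)"
        using N B0 m_large by (intro mult_left_mono powr_mono) auto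
      also have "\<dots> = B * (1 / real N ^ 2)"
        using N by (simp add: powr_minus powr_numeral inverse_eq_divide)
      finally have "expectation (\<lambda>\<omega>. Y N \<omega> / s N) \<le> B * (1 / real N ^ 2)" .
      moreover have "expectation (\<lambda>\<omega>. Y N \<omega> / s N) \<ge> 0"
        using Y0 by (intro integral_nonneg_AE) (simp add: s_def)
      ultimately show "norm (expectation (\<lambda>\<omega>. Y N \<omega> / s N)) \<le> B * (1 / real N ^ 2)" by simp
    qed
  qed
  then show ?thesis
  proof (rule AE_mp, intro AE_I2 impI)
    fix \<omega> assume "\<exists>C. \<forall>N. Y N \<omega> / s N \<le> C"
    then obtain C where C: "Y N \<omega> / s N \<le> C" for N by blast
    \<comment> \<open>Raising the constant to at least 1 gives \<open>C \<le> C' ^ (2 * m)\<close>,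
      so no root of \<open>C\<close> has to be taken.\<close>
    define C' where "C' = max 1 C"
    have C': "C' \<ge> 1" "C \<le> C' ^ (2 * m)"
    proof -
      show 1: "C' \<ge> 1" by (simp add: C'_def)
      have "C' ^ 1 \<le> C' ^ (2 * m)" using 1 m by (intro power_increasing) auto
      then show "C \<le> C' ^ (2 * m)" by (simp add: C'_def)
    qed
    have "\<bar>x \<bullet> (?R N \<omega> *\<^sub>v x)\<bar> \<le> C' * real N powr (1/2 + \<epsilon>) * (x \<bullet> x)"
      if N: "N \<ge> 1" and x: "x \<in> carrier_vec N" for N x
    proof (rule symmetric_quadratic_bound[OF _ _ _ _ m x])
      have "s N > 0" using N by (simp add: s_def)
      then have "Y N \<omega> \<le> C * s N" using C[of N] by (simp add: field_simps)
      also have "\<dots> \<le> C' ^ (2 * m) * s N" using C'(2) \<open>s N > 0\<close> by (intro mult_right_mono) auto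
      also have "\<dots> = (C' * real N powr (1/2 + \<epsilon>)) ^ (2 * m)" by (simp add: s_def power_mult_distrib)
      finally show "(\<Sum>w | w \<in> walks N (2 * m) \<and> w 0 = w (2 * m). \<Prod>t<2 * m. ?R N \<omega> $$ (w t, w (Suc t)))
          \<le> (C' * real N powr (1/2 + \<epsilon>)) ^ (2 * m)" unfolding Y_def .
    qed (use C' in \<open>simp_all add: offpattern_matrix_symmetric\<close>)
    then show "\<exists>C \<ge> 0. \<forall>N \<ge> 1. \<forall>x \<in> carrier_vec N.
        \<bar>x \<bullet> (?R N \<omega> *\<^sub>v x)\<bar> \<le> C * real N powr (1/2 + \<epsilon>) * (x \<bullet> x)"
      using C'(1) by (intro exI[of _ C']) auto
  qed
qed

text \<open>The labelling \<open>g\<close> encodes the regimes: label 0 marks the bulk, a nonzero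
  label \<open>v\<close> the eigenvalues near \<open>N * v / k\<close>, and the cardinalities are
  the sizes of the regimes with multiplicity.\<close>

theorem mainTheorem1:
  fixes M :: "'s measure" and k :: nat and W :: "nat \<Rightarrow> real"
    and a :: "nat \<Rightarrow> nat \<Rightarrow> nat \<Rightarrow> 's \<Rightarrow> real" and D :: "real measure" and \<epsilon> :: real
  assumes "prob_space M"
    and "k \<ge> 1"
    and rv: "\<And>N i j. 1 \<le> i \<Longrightarrow> i < j \<Longrightarrow> j \<le> N \<Longrightarrow> a N i j \<in> borel_measurable M"
    and indep: "prob_space.indep_vars M (\<lambda>_. borel) (\<lambda>(N, i, j). a N i j)
                  {(N, i, j). 1 \<le> i \<and> i < j \<and> j \<le> N}"
    and ident: "\<And>N i j. 1 \<le> i \<Longrightarrow> i < j \<Longrightarrow> j \<le> N \<Longrightarrow> distr M borel (a N i j) = D"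
    and moments: "\<And>N i j n. 1 \<le> i \<Longrightarrow> i < j \<Longrightarrow> j \<le> N \<Longrightarrow>
                    integrable M (\<lambda>\<omega>. \<bar>a N i j \<omega>\<bar> ^ n)"
    and mean: "\<And>N i j. 1 \<le> i \<Longrightarrow> i < j \<Longrightarrow> j \<le> N \<Longrightarrow> (\<integral>\<omega>. a N i j \<omega> \<partial>M) = 0"
    and var: "\<And>N i j. 1 \<le> i \<Longrightarrow> i < j \<Longrightarrow> j \<le> N \<Longrightarrow> (\<integral>\<omega>. (a N i j \<omega>)\<^sup>2 \<partial>M) = 1"
    and "\<epsilon> > 0"
  shows "AE \<omega> in M. \<exists>C. \<forall>\<^sub>F N in sequentially.
           \<exists>(lam :: nat \<Rightarrow> real) (g :: nat \<Rightarrow> real).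
             char_poly (checkerboard_matrix k W (\<lambda>i j. a N i j \<omega>) N) = (\<Prod>i<N. [:- lam i, 1:])
           \<and> (\<forall>i<N. g i \<in> insert 0 (W ` {1..k}))
           \<and> card {i. i < N \<and> g i = 0} = N - card {u \<in> {1..k}. W u \<noteq> 0}
           \<and> (\<forall>v \<in> W ` {1..k}. v \<noteq> 0 \<longrightarrow>
                 card {i. i < N \<and> g i = v} = card {u \<in> {1..k}. W u = v})
           \<and> (\<forall>i<N. \<bar>lam i - real N * g i / real k\<bar> \<le> C * real N powr (1/2 + \<epsilon>))"
proof -
  have "AE \<omega> in M. \<exists>C \<ge> 0. \<forall>N \<ge> 1. \<forall>x \<in> carrier_vec N.
    \<bar>x \<bullet> (offpattern_matrix k (\<lambda>i j. a N i j \<omega>) N *\<^sub>v x)\<bar> \<le> C * real N powr (1/2 + \<epsilon>) * (x \<bullet> x)"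
    by (rule offpattern_spectral_radius_growth) fact+
  then show ?thesis
  proof (rule AE_mp, intro AE_I2 impI)
    fix \<omega> assume "\<exists>C \<ge> 0. \<forall>N \<ge> 1. \<forall>x \<in> carrier_vec N.
      \<bar>x \<bullet> (offpattern_matrix k (\<lambda>i j. a N i j \<omega>) N *\<^sub>v x)\<bar> \<le> C * real N powr (1/2 + \<epsilon>) * (x \<bullet> x)"
    then obtain C where C: "\<bar>x \<bullet> (offpattern_matrix k (\<lambda>i j. a N i j \<omega>) N *\<^sub>v x)\<bar>
        \<le> C * real N powr (1/2 + \<epsilon>) * (x \<bullet> x)" if "N \<ge> 1" "x \<in> carrier_vec N" for N x
      by blast
    let ?w = "2 * (\<Sum>u=1..k. \<bar>W u\<bar>)"
    \<comment> \<open>The error from rounding class sizes is bounded, and is absorbed because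
      \<open>real N powr (1/2 + \<epsilon>)\<close> is at least 1.\<close>
    have le: "C * real N powr (1/2 + \<epsilon>) + ?w \<le> (C + ?w) * real N powr (1/2 + \<epsilon>)" if "N \<ge> 1" for N
    proof -
      have "real N powr (1/2 + \<epsilon>) \<ge> 1" using that \<open>\<epsilon> > 0\<close> by (intro ge_one_powr_ge_zero) auto
      then have "?w * 1 \<le> ?w * real N powr (1/2 + \<epsilon>)" by (intro mult_left_mono) (simp_all add: sum_nonneg)
      then show ?thesis by (simp add: distrib_right)
    qed
    show "\<exists>C. \<forall>\<^sub>F N in sequentially.
           \<exists>(lam :: nat \<Rightarrow> real) (g :: nat \<Rightarrow> real).
             char_poly (checkerboard_matrix k W (\<lambda>i j. a N i j \<omega>) N) = (\<Prod>i<N. [:- lam i, 1:])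
           \<and> (\<forall>i<N. g i \<in> insert 0 (W ` {1..k}))
           \<and> card {i. i < N \<and> g i = 0} = N - card {u \<in> {1..k}. W u \<noteq> 0}
           \<and> (\<forall>v \<in> W ` {1..k}. v \<noteq> 0 \<longrightarrow>
                 card {i. i < N \<and> g i = v} = card {u \<in> {1..k}. W u = v})
           \<and> (\<forall>i<N. \<bar>lam i - real N * g i / real k\<bar> \<le> C * real N powr (1/2 + \<epsilon>))"
    \<comment> \<open>The spectrum of the constant part is available once \<open>N \<ge> k\<close>,
      which holds eventually.\<close>
    proof (rule exI[of _ "C + ?w"], rule eventually_mono[OF eventually_ge_at_top[of k]], goal_cases)
      case (1 N)
      then have N: "N \<ge> 1" using \<open>k \<ge> 1\<close> by simp
      show ?case
        using checkerboard_spectrum[OF \<open>k \<ge> 1\<close> 1 C[OF N], of W] order_trans[OF _ le[OF N]] by meson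
    qed
  qed
qed

end
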